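(* Let $p$ be a prime number and let $r$ be a natural number. Assume that $(\mathbb{Z}_p)^r$ is not a DCI group. If either of the following is true, then $(\mathbb{Z}_p)^{r+2}$ is not a CI group: (1) $p \neq 3$; or (2) there is a subset $S \subseteq (\mathbb{Z}_p)^r$ with $|S| < p^{r-1}$ such that the Cayley digraph $\overrightarrow{\mathrm{Cay}}\bigl((\mathbb{Z}_p)^r; S\bigr)$ is not a DCI digraph.
   Context: Let $G$ be a finite group. For a subset $S \subseteq G$, the Cayley digraph $\overrightarrow{\mathrm{Cay}}(G;S)$ is the directed graph with vertex set $G$ and with a directed edge $g \to h$ if and only if $h \in Sg$ (loops are allowed, i.e. $S$ may contain the identity). If $S = S^{-1}$ ($S$ is symmetric), it can be viewed as an undirected graph, called a Cayley graph and denoted $\mathrm{Cay}(G;S)$. A Cayley digraph $\overrightarrow{\mathrm{Cay}}(G;S)$ is a DCI digraph if, for every subset $S'$ of $G$ such that $\overrightarrow{\mathrm{Cay}}(G;S) \cong \overrightarrow{\mathrm{Cay}}(G;S')$, there is a group automorphism $\alpha$ of $G$ with $\alpha(S)=S'$. A Cayley graph $\mathrm{Cay}(G;S)$ is a CI graph if, for every symmetric subset $S'$ of $G$ such that $\mathrm{Cay}(G;S) \cong \mathrm{Cay}(G;S')$, there is a group automorphism $\alpha$ of $G$ with $\alpha(S)=S'$. $G$ is a DCI group if every Cayley digraph of $G$ is a DCI digraph, and $G$ is a CI group if every (undirected) Cayley graph of $G$ is a CI graph. *)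

theory Defs
  imports
    "HOL-Algebra.Bij"
    "HOL-Algebra.Coset"
    "HOL-Algebra.Product_Groups"
    "HOL-Computational_Algebra.Primes"
    "Graph_Theory.Digraph"
    "Graph_Theory.Digraph_Isomorphism"
begin

abbreviation Zmod_power :: "nat \<Rightarrow> nat \<Rightarrow> (nat \<Rightarrow> int) monoid" where
  "Zmod_power p r \<equiv> product_group {..<r} (\<lambda>_. integer_mod_group p)"

definition cayley_digraph :: "('a, 'b) monoid_scheme \<Rightarrow> 'a set \<Rightarrow> ('a, 'a \<times> 'a) pre_digraph" where
  "cayley_digraph G S =
    \<lparr> verts = carrier G,
      arcs = {(g, h). g \<in> carrier G \<and> h \<in> S #>\<^bsub>G\<^esub> g},
      tail = fst,
      head = snd \<rparr>"

definition symmetric_subset :: "('a, 'b) monoid_scheme \<Rightarrow> 'a set \<Rightarrow> bool" where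
  "symmetric_subset G S \<longleftrightarrow> S \<subseteq> carrier G \<and> S = set_inv\<^bsub>G\<^esub> S"

text \<open>
  In the library, an undirected graph (with loops allowed) is a digraph whose arc relation is
  symmetric, i.e. a \<^locale>\<open>pseudo_graph\<close>. Accordingly, for symmetric \<open>S\<close> the Cayley graph is the
  Cayley digraph itself. On such digraphs \<^const>\<open>digraph_iso\<close> is isomorphism of undirected graphs.
\<close>

lemma (in group) pseudo_graph_cayley_digraph:
  assumes "finite (carrier G)" and "symmetric_subset G S"
  shows "pseudo_graph (cayley_digraph G S)"
proof -
  have S: "S \<subseteq> carrier G" and inv_S: "\<And>s. s \<in> S \<Longrightarrow> inv s \<in> S"
    using assms(2) unfolding symmetric_subset_def SET_INV_def by blast+
  have arc: "g \<in> carrier G" "h \<in> carrier G" "(h, g) \<in> arcs (cayley_digraph G S)"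
    if gh: "(g, h) \<in> arcs (cayley_digraph G S)" for g h
  proof -
    from gh obtain s where s: "g \<in> carrier G" "s \<in> S" "h = s \<otimes> g"
      by (auto simp: cayley_digraph_def r_coset_def)
    then have sc: "s \<in> carrier G" using S by blast
    show "g \<in> carrier G" and h: "h \<in> carrier G" using s sc by auto
    have "g = inv s \<otimes> h" using s sc by (metis inv_solve_left' h)
    then show "(h, g) \<in> arcs (cayley_digraph G S)"
      using h inv_S[OF s(2)] by (auto simp: cayley_digraph_def r_coset_def)
  qed
  have sub: "arcs (cayley_digraph G S) \<subseteq> carrier G \<times> carrier G"
    using arc by auto
  have "finite (arcs (cayley_digraph G S))"
    using assms(1) by (rule finite_subset[OF sub finite_cartesian_product]) fact
  moreover have ends_eq: "arcs_ends (cayley_digraph G S) = arcs (cayley_digraph G S)"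
    by (auto simp: arcs_ends_def arc_to_ends_def cayley_digraph_def)
  moreover have verts_eq: "verts (cayley_digraph G S) = carrier G"
    and "tail (cayley_digraph G S) = fst" and "head (cayley_digraph G S) = snd"
    by (simp_all add: cayley_digraph_def)
  ultimately show ?thesis
    using sub arc(3) assms(1)
    by unfold_locales
      (auto simp: symmetric_def verts_eq ends_eq intro: symI)
qed

definition is_DCI_digraph :: "('a, 'b) monoid_scheme \<Rightarrow> 'a set \<Rightarrow> bool" where
  "is_DCI_digraph G S \<longleftrightarrow>
    (\<forall>S'. S' \<subseteq> carrier G \<and> digraph_iso (cayley_digraph G S) (cayley_digraph G S') \<longrightarrow>
      (\<exists>\<alpha>\<in>auto G. \<alpha> ` S = S'))"

definition is_CI_graph :: "('a, 'b) monoid_scheme \<Rightarrow> 'a set \<Rightarrow> bool" where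
  "is_CI_graph G S \<longleftrightarrow>
    (\<forall>S'. symmetric_subset G S' \<and> digraph_iso (cayley_digraph G S) (cayley_digraph G S') \<longrightarrow>
      (\<exists>\<alpha>\<in>auto G. \<alpha> ` S = S'))"

definition is_DCI_group :: "('a, 'b) monoid_scheme \<Rightarrow> bool" where
  "is_DCI_group G \<longleftrightarrow> (\<forall>S. S \<subseteq> carrier G \<longrightarrow> is_DCI_digraph G S)"

definition is_CI_group :: "('a, 'b) monoid_scheme \<Rightarrow> bool" where
  "is_CI_group G \<longleftrightarrow> (\<forall>S. symmetric_subset G S \<longrightarrow> is_CI_graph G S)"

end

theory Submission
  imports Defs
begin

text \<open>
  Let \<open>S\<close> and \<open>S'\<close> give isomorphic Cayley digraphs of \<open>V = Z_p^r\<close> but lie in different orbits of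
  \<open>Aut V\<close>. For \<open>p = 2\<close> every subset is symmetric, and after passing to complements \<open>S\<close> generates \<open>V\<close>;
  an automorphism of \<open>V \<times> Z_2^2\<close> that maps \<open>S \<times> 1\<close> to \<open>S' \<times> 1\<close> then restricts to \<open>V\<close>. For \<open>p > 2\<close>,
  let \<open>a, b\<close> be a basis of \<open>W = Z_p^2\<close> and join the cosets of \<open>V\<close> in \<open>V \<times> W\<close> by the symmetric
  connection set consisting of \<open>V\<close> itself, \<open>S\<close> over \<open>a\<close>, \<open>- S\<close> over \<open>- a\<close>, and the identity of \<open>V\<close>
  over \<open>b\<close>, \<open>- b\<close>, \<open>a + b\<close> and \<open>- (a + b)\<close>. An automorphism mapping this set for \<open>S\<close> to the one for
  \<open>S'\<close> must preserve \<open>V\<close>: if \<open>p > 3\<close>, only elements of \<open>V\<close> have their double in the set; if \<open>p = 3\<close> and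
  \<open>3 |S| < |V|\<close>, no other subgroup of order \<open>|V|\<close> fits into the set. As \<open>|S| \<ge> 2\<close> (after adjoining the
  identity to a singleton), it permutes the elements over \<open>b\<close>, \<open>a + b\<close> and their negatives,
  hence maps \<open>(1, a)\<close> to \<open>(1, a)\<close> or \<open>(1, - a)\<close>, and so its
  restriction to \<open>V\<close> maps \<open>S\<close> to \<open>S'\<close> or \<open>- S'\<close>.
\<close>

section \<open>Cayley digraph isomorphisms as vertex bijections\<close>

text \<open>Only the vertex map is kept, and an arc from g to h appears as the condition that the
  quotient of h by g lies in the connection set. Source and target groups may differ, so that these
  maps compose with group isomorphisms.\<close>

definition cayley_iso ::
  "('a, 'b) monoid_scheme \<Rightarrow> 'a set \<Rightarrow> ('c, 'd) monoid_scheme \<Rightarrow> 'c set \<Rightarrow> ('a \<Rightarrow> 'c) \<Rightarrow> bool" where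
  "cayley_iso G S H T \<phi> \<longleftrightarrow> bij_betw \<phi> (carrier G) (carrier H) \<and>
    (\<forall>g\<in>carrier G. \<forall>h\<in>carrier G. h \<otimes>\<^bsub>G\<^esub> inv\<^bsub>G\<^esub> g \<in> S \<longleftrightarrow> \<phi> h \<otimes>\<^bsub>H\<^esub> inv\<^bsub>H\<^esub> (\<phi> g) \<in> T)"

lemma cayley_isoI:
  assumes "bij_betw \<phi> (carrier G) (carrier H)"
    and "\<And>g h. g \<in> carrier G \<Longrightarrow> h \<in> carrier G \<Longrightarrow>
      h \<otimes>\<^bsub>G\<^esub> inv\<^bsub>G\<^esub> g \<in> S \<longleftrightarrow> \<phi> h \<otimes>\<^bsub>H\<^esub> inv\<^bsub>H\<^esub> (\<phi> g) \<in> T"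
  shows "cayley_iso G S H T \<phi>"
  using assms unfolding cayley_iso_def by blast

lemma cayley_iso_trans:
  assumes "cayley_iso G S H T \<phi>" "cayley_iso H T K U \<psi>"
  shows "cayley_iso G S K U (\<psi> \<circ> \<phi>)"
  using assms bij_betw_trans[of \<phi> "carrier G" "carrier H" \<psi> "carrier K"]
  unfolding cayley_iso_def by (auto dest: bij_betwE)

lemma cayley_iso_inv:
  assumes "cayley_iso G S H T \<phi>"
  shows "cayley_iso H T G S (inv_into (carrier G) \<phi>)"
proof (rule cayley_isoI)
  have bij: "bij_betw \<phi> (carrier G) (carrier H)"
    using assms unfolding cayley_iso_def by blast
  show inv: "bij_betw (inv_into (carrier G) \<phi>) (carrier H) (carrier G)"
    by (rule bij_betw_inv_into[OF bij])
  show "h \<otimes>\<^bsub>H\<^esub> inv\<^bsub>H\<^esub> g \<in> T \<longleftrightarrow>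
      inv_into (carrier G) \<phi> h \<otimes>\<^bsub>G\<^esub> inv\<^bsub>G\<^esub> (inv_into (carrier G) \<phi> g) \<in> S"
    if "g \<in> carrier H" "h \<in> carrier H" for g h
    using that assms bij_betwE[OF inv] bij_betw_inv_into_right[OF bij]
    unfolding cayley_iso_def by simp
qed

lemma (in group) arcs_cayley_digraph:
  assumes "S \<subseteq> carrier G"
  shows "arcs (cayley_digraph G S) = {(g, h). g \<in> carrier G \<and> h \<in> carrier G \<and> h \<otimes> inv g \<in> S}"
proof -
  have "h \<in> S #> g \<longleftrightarrow> h \<in> carrier G \<and> h \<otimes> inv g \<in> S" if "g \<in> carrier G" for g h
  proof
    assume "h \<in> S #> g"
    then obtain s where "s \<in> S" "h = s \<otimes> g" by (auto simp: r_coset_def)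
    then show "h \<in> carrier G \<and> h \<otimes> inv g \<in> S"
      using assms that by (auto simp: m_assoc subset_iff)
  next
    assume h: "h \<in> carrier G \<and> h \<otimes> inv g \<in> S"
    then have "h = (h \<otimes> inv g) \<otimes> g" using that by (simp add: m_assoc)
    then show "h \<in> S #> g" using h unfolding r_coset_def by blast
  qed
  then show ?thesis by (auto simp: cayley_digraph_def)
qed

text \<open>A library isomorphism also carries an arc map and new head and tail functions. The arcs
  of a Cayley digraph are pairs with \<open>fst\<close> and \<open>snd\<close> as ends, so the
  vertex map determines the arc map; conversely a vertex map \<phi> extends by
  \<open>map_prod \<phi> \<phi>\<close>.\<close>

lemma digraph_iso_cayley_iff:
  assumes G: "group G" and H: "group H" and S: "S \<subseteq> carrier G" and T: "T \<subseteq> carrier H"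
  shows "digraph_iso (cayley_digraph G S) (cayley_digraph H T) \<longleftrightarrow> (\<exists>\<phi>. cayley_iso G S H T \<phi>)"
proof
  note arcs = group.arcs_cayley_digraph[OF G S] group.arcs_cayley_digraph[OF H T]
  assume "digraph_iso (cayley_digraph G S) (cayley_digraph H T)"
  then obtain f where f: "pre_digraph.digraph_isomorphism (cayley_digraph G S) f"
    and eq: "cayley_digraph H T = app_iso f (cayley_digraph G S)"
    unfolding digraph_iso_def by blast
  have inj: "inj_on (iso_verts f) (carrier G)"
    and ends: "\<And>a. a \<in> arcs (cayley_digraph G S) \<Longrightarrow>
      iso_verts f (fst a) = iso_tail f (iso_arcs f a) \<and>
      iso_verts f (snd a) = iso_head f (iso_arcs f a)"
    using f by (auto simp: pre_digraph.digraph_isomorphism_def cayley_digraph_def)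
  have carr: "iso_verts f ` carrier G = carrier H"
    and ar: "iso_arcs f ` arcs (cayley_digraph G S) = arcs (cayley_digraph H T)"
    and hd: "iso_head f = snd" and tl: "iso_tail f = fst"
    using arg_cong[OF eq, of verts] arg_cong[OF eq, of arcs]
      arg_cong[OF eq, of head] arg_cong[OF eq, of tail]
    by (simp_all add: cayley_digraph_def)
  have arc: "iso_arcs f a = (iso_verts f (fst a), iso_verts f (snd a))"
    if "a \<in> arcs (cayley_digraph G S)" for a
    using ends[OF that] by (simp add: hd tl prod_eq_iff)
  have "cayley_iso G S H T (iso_verts f)"
  proof (rule cayley_isoI)
    show "bij_betw (iso_verts f) (carrier G) (carrier H)"
      using inj carr by (simp add: bij_betw_def)
    fix g h assume gh: "g \<in> carrier G" "h \<in> carrier G"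
    have "h \<otimes>\<^bsub>G\<^esub> inv\<^bsub>G\<^esub> g \<in> S \<longleftrightarrow> (g, h) \<in> arcs (cayley_digraph G S)"
      using gh by (simp add: arcs)
    also have "\<dots> \<longleftrightarrow> (iso_verts f g, iso_verts f h) \<in> arcs (cayley_digraph H T)"
    proof
      assume "(g, h) \<in> arcs (cayley_digraph G S)"
      then show "(iso_verts f g, iso_verts f h) \<in> arcs (cayley_digraph H T)"
        using arc ar by force
    next
      assume "(iso_verts f g, iso_verts f h) \<in> arcs (cayley_digraph H T)"
      then obtain a where a: "a \<in> arcs (cayley_digraph G S)"
        "iso_verts f (fst a) = iso_verts f g" "iso_verts f (snd a) = iso_verts f h"
        using arc ar by (metis (no_types, lifting) fst_conv imageE snd_conv)
      moreover have "fst a \<in> carrier G" "snd a \<in> carrier G"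
        using a(1) by (auto simp: arcs)
      ultimately have "a = (g, h)"
        using gh inj by (auto simp: prod_eq_iff dest: inj_onD)
      then show "(g, h) \<in> arcs (cayley_digraph G S)" using a(1) by simp
    qed
    also have "\<dots> \<longleftrightarrow> iso_verts f h \<otimes>\<^bsub>H\<^esub> inv\<^bsub>H\<^esub> (iso_verts f g) \<in> T"
      using gh carr by (auto simp: arcs)
    finally show "h \<otimes>\<^bsub>G\<^esub> inv\<^bsub>G\<^esub> g \<in> S \<longleftrightarrow> iso_verts f h \<otimes>\<^bsub>H\<^esub> inv\<^bsub>H\<^esub> (iso_verts f g) \<in> T" .
  qed
  then show "\<exists>\<phi>. cayley_iso G S H T \<phi>" by blast
next
  note arcs = group.arcs_cayley_digraph[OF G S] group.arcs_cayley_digraph[OF H T]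
  assume "\<exists>\<phi>. cayley_iso G S H T \<phi>"
  then obtain \<phi> where bij: "bij_betw \<phi> (carrier G) (carrier H)"
    and \<phi>: "\<And>g h. g \<in> carrier G \<Longrightarrow> h \<in> carrier G \<Longrightarrow>
      h \<otimes>\<^bsub>G\<^esub> inv\<^bsub>G\<^esub> g \<in> S \<longleftrightarrow> \<phi> h \<otimes>\<^bsub>H\<^esub> inv\<^bsub>H\<^esub> (\<phi> g) \<in> T"
    unfolding cayley_iso_def by blast
  have inj: "inj_on \<phi> (carrier G)" and img: "\<phi> ` carrier G = carrier H"
    using bij by (auto simp: bij_betw_def)
  define f where "f = \<lparr>iso_verts = \<phi>, iso_arcs = map_prod \<phi> \<phi>, iso_head = snd, iso_tail = fst\<rparr>"
  have "wf_digraph (cayley_digraph G S)"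
    using arcs(1) by unfold_locales (auto simp: cayley_digraph_def)
  moreover have "inj_on (map_prod \<phi> \<phi>) (arcs (cayley_digraph G S))"
    using inj by (auto simp: arcs inj_on_def)
  ultimately have "pre_digraph.digraph_isomorphism (cayley_digraph G S) f"
    using inj by (simp add: pre_digraph.digraph_isomorphism_def f_def cayley_digraph_def)
  moreover have "arcs (cayley_digraph H T) = map_prod \<phi> \<phi> ` arcs (cayley_digraph G S)"
  proof (intro equalityI subsetI)
    fix x assume "x \<in> arcs (cayley_digraph H T)"
    then obtain g h where gh: "g \<in> carrier G" "h \<in> carrier G" "x = (\<phi> g, \<phi> h)"
        "\<phi> h \<otimes>\<^bsub>H\<^esub> inv\<^bsub>H\<^esub> (\<phi> g) \<in> T"
      unfolding arcs img[symmetric] by auto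
    then have "(g, h) \<in> arcs (cayley_digraph G S)" by (simp add: arcs \<phi>)
    then show "x \<in> map_prod \<phi> \<phi> ` arcs (cayley_digraph G S)"
      using gh(3) by (metis imageI map_prod_simp)
  qed (use img in \<open>auto simp: arcs \<phi>\<close>)
  then have "cayley_digraph H T = app_iso f (cayley_digraph G S)"
    using img by (simp add: app_iso_def f_def) (simp add: cayley_digraph_def)
  ultimately show "digraph_iso (cayley_digraph G S) (cayley_digraph H T)"
    unfolding digraph_iso_def by blast
qed

text \<open>The out-neighbourhood of the identity is \<open>S\<close>, and that of its image
  \<open>u\<close> is the translate of \<open>T\<close> by \<open>u\<close>. Following \<phi> by
  right multiplication with the inverse of \<open>u\<close> therefore maps \<open>S\<close>
  bijectively onto \<open>T\<close>.\<close>

lemma cayley_iso_card: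
  assumes G: "group G" and H: "group H" and S: "S \<subseteq> carrier G" and T: "T \<subseteq> carrier H"
    and iso: "cayley_iso G S H T \<phi>"
  shows "card S = card T"
proof -
  interpret G: group G by fact
  interpret H: group H by fact
  have bij: "bij_betw \<phi> (carrier G) (carrier H)"
    and \<phi>: "\<And>g h. g \<in> carrier G \<Longrightarrow> h \<in> carrier G \<Longrightarrow>
      h \<otimes>\<^bsub>G\<^esub> inv\<^bsub>G\<^esub> g \<in> S \<longleftrightarrow> \<phi> h \<otimes>\<^bsub>H\<^esub> inv\<^bsub>H\<^esub> (\<phi> g) \<in> T"
    using iso unfolding cayley_iso_def by blast+
  define u where "u = \<phi> \<one>\<^bsub>G\<^esub>"
  have u: "u \<in> carrier H" unfolding u_def using bij_betwE[OF bij] by simp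
  have mem: "h \<in> S \<longleftrightarrow> \<phi> h \<otimes>\<^bsub>H\<^esub> inv\<^bsub>H\<^esub> u \<in> T" if "h \<in> carrier G" for h
    using \<phi>[of "\<one>\<^bsub>G\<^esub>" h] that by (simp add: u_def)
  have "(\<lambda>h. \<phi> h \<otimes>\<^bsub>H\<^esub> inv\<^bsub>H\<^esub> u) ` S = T"
  proof (intro equalityI subsetI)
    fix t assume t: "t \<in> T"
    then have "t \<otimes>\<^bsub>H\<^esub> u \<in> carrier H" using T u by auto
    then obtain h where h: "h \<in> carrier G" "\<phi> h = t \<otimes>\<^bsub>H\<^esub> u"
      using bij by (metis bij_betw_imp_surj_on imageE)
    have "\<phi> h \<otimes>\<^bsub>H\<^esub> inv\<^bsub>H\<^esub> u = t" using h t T u by (auto simp: H.m_assoc subset_iff)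
    then show "t \<in> (\<lambda>h. \<phi> h \<otimes>\<^bsub>H\<^esub> inv\<^bsub>H\<^esub> u) ` S" using mem[OF h(1)] t by force
  qed (use mem S in auto)
  moreover have "inj_on (\<lambda>h. \<phi> h \<otimes>\<^bsub>H\<^esub> inv\<^bsub>H\<^esub> u) S"
  proof (rule inj_onI)
    fix x y assume xy: "x \<in> S" "y \<in> S" "\<phi> x \<otimes>\<^bsub>H\<^esub> inv\<^bsub>H\<^esub> u = \<phi> y \<otimes>\<^bsub>H\<^esub> inv\<^bsub>H\<^esub> u"
    then have xyG: "x \<in> carrier G" "y \<in> carrier G" using S by auto
    then have "\<phi> x \<in> carrier H" "\<phi> y \<in> carrier H" using bij_betwE[OF bij] by auto
    then have "\<phi> x = \<phi> y" using xy(3) u by simp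
    then show "x = y" using xyG bij by (auto simp: bij_betw_def dest: inj_onD)
  qed
  ultimately show ?thesis using card_image by fastforce
qed

text \<open>The identity lies in the connection set exactly when the vertices carry loops.\<close>

lemma cayley_iso_one_mem:
  assumes G: "group G" and H: "group H" and iso: "cayley_iso G S H T \<phi>"
  shows "\<one>\<^bsub>G\<^esub> \<in> S \<longleftrightarrow> \<one>\<^bsub>H\<^esub> \<in> T"
proof -
  interpret G: group G by fact
  interpret H: group H by fact
  have "\<phi> \<one>\<^bsub>G\<^esub> \<in> carrier H" using iso unfolding cayley_iso_def by (meson G.one_closed bij_betwE)
  moreover have "\<one>\<^bsub>G\<^esub> \<otimes>\<^bsub>G\<^esub> inv\<^bsub>G\<^esub> \<one>\<^bsub>G\<^esub> \<in> S \<longleftrightarrow> \<phi> \<one>\<^bsub>G\<^esub> \<otimes>\<^bsub>H\<^esub> inv\<^bsub>H\<^esub> (\<phi> \<one>\<^bsub>G\<^esub>) \<in> T"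
    using iso unfolding cayley_iso_def by (meson G.one_closed)
  ultimately show ?thesis by simp
qed

text \<open>Putting a loop at every vertex is compatible with every bijection. This serves to
  enlarge singleton connection sets.\<close>

lemma cayley_iso_insert_one:
  assumes G: "group G" and H: "group H" and iso: "cayley_iso G S H T \<phi>"
  shows "cayley_iso G (insert \<one>\<^bsub>G\<^esub> S) H (insert \<one>\<^bsub>H\<^esub> T) \<phi>"
proof (rule cayley_isoI)
  interpret G: group G by fact
  interpret H: group H by fact
  show bij: "bij_betw \<phi> (carrier G) (carrier H)" using iso unfolding cayley_iso_def by blast
  fix g h assume gh: "g \<in> carrier G" "h \<in> carrier G"
  have "h \<otimes>\<^bsub>G\<^esub> inv\<^bsub>G\<^esub> g = \<one>\<^bsub>G\<^esub> \<longleftrightarrow> h = g"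
    using gh by (metis G.inv_equality G.inv_inv G.inv_closed G.r_inv)
  also have "\<dots> \<longleftrightarrow> \<phi> h = \<phi> g"
    using gh bij by (auto simp: bij_betw_def dest: inj_onD)
  also have "\<dots> \<longleftrightarrow> \<phi> h \<otimes>\<^bsub>H\<^esub> inv\<^bsub>H\<^esub> (\<phi> g) = \<one>\<^bsub>H\<^esub>"
    using gh bij_betwE[OF bij] by (metis H.inv_equality H.inv_inv H.inv_closed H.r_inv)
  finally show "h \<otimes>\<^bsub>G\<^esub> inv\<^bsub>G\<^esub> g \<in> insert \<one>\<^bsub>G\<^esub> S \<longleftrightarrow>
      \<phi> h \<otimes>\<^bsub>H\<^esub> inv\<^bsub>H\<^esub> (\<phi> g) \<in> insert \<one>\<^bsub>H\<^esub> T"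
    using iso gh unfolding cayley_iso_def by auto
qed

text \<open>A bijection that preserves and reflects arcs does the same for non-arcs. For p = 2 this
  allows a non-generating set to be replaced by its complement.\<close>

lemma cayley_iso_Compl:
  assumes G: "group G" and H: "group H" and iso: "cayley_iso G S H T \<phi>"
  shows "cayley_iso G (carrier G - S) H (carrier H - T) \<phi>"
proof (rule cayley_isoI)
  show bij: "bij_betw \<phi> (carrier G) (carrier H)" using iso unfolding cayley_iso_def by blast
  fix g h assume gh: "g \<in> carrier G" "h \<in> carrier G"
  interpret G: group G by fact
  interpret H: group H by fact
  show "h \<otimes>\<^bsub>G\<^esub> inv\<^bsub>G\<^esub> g \<in> carrier G - S \<longleftrightarrow> \<phi> h \<otimes>\<^bsub>H\<^esub> inv\<^bsub>H\<^esub> (\<phi> g) \<in> carrier H - T"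
    using iso gh bij_betwE[OF bij] unfolding cayley_iso_def by auto
qed

lemma cayley_iso_group_iso:
  assumes G: "group G" and H: "group H" and S: "S \<subseteq> carrier G" and \<psi>: "\<psi> \<in> iso G H"
  shows "cayley_iso G S H (\<psi> ` S) \<psi>"
proof (rule cayley_isoI)
  interpret group_hom G H \<psi>
    using assms by (simp add: group_hom_def group_hom_axioms_def iso_def)
  show bij: "bij_betw \<psi> (carrier G) (carrier H)" using \<psi> by (simp add: iso_def)
  fix g h assume gh: "g \<in> carrier G" "h \<in> carrier G"
  have "h \<otimes>\<^bsub>G\<^esub> inv\<^bsub>G\<^esub> g \<in> S \<longleftrightarrow> \<psi> (h \<otimes>\<^bsub>G\<^esub> inv\<^bsub>G\<^esub> g) \<in> \<psi> ` S"
    using gh S bij inj_on_image_mem_iff[of \<psi> "carrier G" "h \<otimes>\<^bsub>G\<^esub> inv\<^bsub>G\<^esub> g" S]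
    by (simp add: bij_betw_def)
  then show "h \<otimes>\<^bsub>G\<^esub> inv\<^bsub>G\<^esub> g \<in> S \<longleftrightarrow> \<psi> h \<otimes>\<^bsub>H\<^esub> inv\<^bsub>H\<^esub> (\<psi> g) \<in> \<psi> ` S"
    using gh by simp
qed

section \<open>Automorphisms and transport along group isomorphisms\<close>

text \<open>Members of \<open>auto G\<close> are extensional, whereas \<open>iso G G\<close> says
  nothing about values outside the carrier; restriction bridges the two.\<close>

lemma restrict_iso_in_auto:
  assumes "group G" "\<alpha> \<in> iso G G"
  shows "restrict \<alpha> (carrier G) \<in> auto G"
proof -
  have "monoid G" using assms(1) by (rule group.is_monoid)
  then show ?thesis
    using assms(2) monoid.m_closed[of G]
    by (auto simp: auto_def iso_def hom_def Bij_def bij_betw_def inj_on_def Pi_def)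
qed

lemma auto_subset_iso: "auto G \<subseteq> iso G G"
  by (auto simp: auto_def iso_def Bij_def)


text \<open>The CI property is invariant under group isomorphism: the pair and \<phi> are carried to
  \<open>H\<close> by \<psi>, and an automorphism found there is conjugated back to
  \<open>G\<close>. Counterexamples may thus be built in a direct product instead of in the function
  space \<open>Zmod_power\<close>.\<close>

lemma not_CI_groupI:
  assumes G: "group G" and H: "group H" and \<psi>: "\<psi> \<in> iso G H"
    and S: "symmetric_subset G S" and T: "symmetric_subset G T"
    and iso: "cayley_iso G S G T \<phi>"
    and no_auto: "\<And>\<alpha>. \<alpha> \<in> iso G G \<Longrightarrow> \<alpha> ` S \<noteq> T"
  shows "\<not> is_CI_group H"
proof
  interpret \<psi>: group_hom G H \<psi>
    using assms by (simp add: group_hom_def group_hom_axioms_def iso_def)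
  have SG: "S \<subseteq> carrier G" and TG: "T \<subseteq> carrier G"
    using S T unfolding symmetric_subset_def by blast+
  have sym: "symmetric_subset H (\<psi> ` X)" if X: "symmetric_subset G X" for X
  proof -
    have XG: "X \<subseteq> carrier G" and Xinv: "X = set_inv\<^bsub>G\<^esub> X"
      using X unfolding symmetric_subset_def by blast+
    have "set_inv\<^bsub>H\<^esub> (\<psi> ` X) = (\<lambda>x. inv\<^bsub>H\<^esub> (\<psi> x)) ` X" by (auto simp: SET_INV_def)
    also have "\<dots> = (\<lambda>x. \<psi> (inv\<^bsub>G\<^esub> x)) ` X" using XG by (intro image_cong) auto
    also have "\<dots> = \<psi> ` (set_inv\<^bsub>G\<^esub> X)" by (auto simp: SET_INV_def)
    also have "\<dots> = \<psi> ` X" by (simp only: Xinv[symmetric])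
    finally have "set_inv\<^bsub>H\<^esub> (\<psi> ` X) = \<psi> ` X" .
    moreover have "\<psi> ` X \<subseteq> carrier H" using XG by auto
    ultimately show ?thesis by (simp add: symmetric_subset_def)
  qed
  have \<psi>SH: "\<psi> ` S \<subseteq> carrier H" and \<psi>TH: "\<psi> ` T \<subseteq> carrier H"
    using sym[OF S] sym[OF T] unfolding symmetric_subset_def by blast+
  note \<psi>_cayley = cayley_iso_group_iso[OF G H _ \<psi>]
  have "cayley_iso H (\<psi> ` S) H (\<psi> ` T) (\<psi> \<circ> (\<phi> \<circ> inv_into (carrier G) \<psi>))"
    by (rule cayley_iso_trans[OF cayley_iso_trans[OF cayley_iso_inv[OF \<psi>_cayley[OF SG]] iso]
          \<psi>_cayley[OF TG]])
  then have "digraph_iso (cayley_digraph H (\<psi> ` S)) (cayley_digraph H (\<psi> ` T))"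
    using digraph_iso_cayley_iff[OF H H \<psi>SH \<psi>TH] by blast
  moreover assume "is_CI_group H"
  ultimately obtain \<alpha> where "\<alpha> \<in> auto H" and \<alpha>S: "\<alpha> ` \<psi> ` S = \<psi> ` T"
    using sym[OF S] sym[OF T] 
    by (meson is_CI_group_def is_CI_graph_def)
  then have "\<alpha> \<in> iso H H" using auto_subset_iso by blast
  then have "inv_into (carrier G) \<psi> \<circ> (\<alpha> \<circ> \<psi>) \<in> iso G G"
    by (rule iso_set_trans[OF iso_set_trans[OF \<psi>] group.iso_set_sym[OF G \<psi>]])
  moreover have "inv_into (carrier G) \<psi> ` \<psi> ` T = T"
    using \<psi> TG inv_into_image_cancel[of \<psi> "carrier G" T] by (simp add: iso_def bij_betw_def)
  then have "(inv_into (carrier G) \<psi> \<circ> (\<alpha> \<circ> \<psi>)) ` S = T"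
    using \<alpha>S by (simp only: image_comp[symmetric])
  ultimately show False by (rule no_auto[THEN notE])
qed


lemma iso_groupI:
  assumes "group G" "\<beta> \<in> hom G G" "inj_on \<beta> (carrier G)" "finite (carrier G)"
  shows "\<beta> \<in> iso G G"
proof -
  have "\<beta> ` carrier G \<subseteq> carrier G" using assms(2) by (auto simp: hom_def)
  then have "\<beta> ` carrier G = carrier G" using assms by (simp add: endo_inj_surj)
  then show ?thesis using assms by (simp add: iso_def bij_betw_def)
qed

section \<open>The symmetric connection set on the product of V and W\<close>

text \<open>The fibre over \<open>a\<close> carries the information and the one over its inverse
  makes the set symmetric. The one-point fibres over \<open>b\<close> and the product of
  \<open>a\<close> and \<open>b\<close> are markers: their quotient is \<open>a\<close>, so they
  prevent an automorphism from shifting the fibre over \<open>a\<close> by an element of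
  \<open>V\<close>.\<close>

definition gadget ::
  "('a, 'b) monoid_scheme \<Rightarrow> ('c, 'd) monoid_scheme \<Rightarrow> 'c \<Rightarrow> 'c \<Rightarrow> 'a set \<Rightarrow> ('a \<times> 'c) set" where
  "gadget V W a b S = {(v, w). v \<in> carrier V \<and>
    (w = \<one>\<^bsub>W\<^esub> \<or> (w = a \<and> v \<in> S) \<or> (w = inv\<^bsub>W\<^esub> a \<and> inv\<^bsub>V\<^esub> v \<in> S) \<or>
     (v = \<one>\<^bsub>V\<^esub> \<and>
      w \<in> {b, inv\<^bsub>W\<^esub> b, a \<otimes>\<^bsub>W\<^esub> b, inv\<^bsub>W\<^esub> (a \<otimes>\<^bsub>W\<^esub> b)}))}"

text \<open>Distinctness keeps the clauses of \<open>gadget\<close> apart, so that \<open>S\<close>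
  can be read off from the fibre over \<open>a\<close>. For the standard basis of the square of Z_p
  it fails at p = 2, where \<open>a\<close> is its own inverse.\<close>

locale gadget_groups = V: comm_group V + W: comm_group W
  for V :: "('a, 'b) monoid_scheme" and W :: "('c, 'd) monoid_scheme" +
  fixes a b :: 'c
  assumes a [simp]: "a \<in> carrier W" and b [simp]: "b \<in> carrier W"
    and fibres_distinct: "distinct [\<one>\<^bsub>W\<^esub>, a, inv\<^bsub>W\<^esub> a, b, inv\<^bsub>W\<^esub> b,
      a \<otimes>\<^bsub>W\<^esub> b, inv\<^bsub>W\<^esub> (a \<otimes>\<^bsub>W\<^esub> b)]"
    and finite_V [simp]: "finite (carrier V)"
begin

abbreviation "G \<equiv> V \<times>\<times> W"
abbreviation "c \<equiv> a \<otimes>\<^bsub>W\<^esub> b"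

sublocale G: group G
  by (intro DirProd_group V.group_axioms W.group_axioms)

lemma inv_G [simp]:
  "v \<in> carrier V \<Longrightarrow> w \<in> carrier W \<Longrightarrow> inv\<^bsub>G\<^esub> (v, w) = (inv\<^bsub>V\<^esub> v, inv\<^bsub>W\<^esub> w)"
  by (intro inv_DirProd V.group_axioms W.group_axioms)

lemma gadget_subset: "gadget V W a b S \<subseteq> carrier G"
  by (auto simp: gadget_def)

lemma mem_gadget_iff:
  assumes "S \<subseteq> carrier V"
  shows "(v, w) \<in> gadget V W a b S \<longleftrightarrow> v \<in> carrier V \<and>
    (w = \<one>\<^bsub>W\<^esub> \<or> (w = a \<and> v \<in> S) \<or> (w = inv\<^bsub>W\<^esub> a \<and> inv\<^bsub>V\<^esub> v \<in> S) \<or>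
     (v = \<one>\<^bsub>V\<^esub> \<and> w \<in> {b, inv\<^bsub>W\<^esub> b, c, inv\<^bsub>W\<^esub> c}))"
  by (simp add: gadget_def)

lemma symmetric_gadget:
  assumes "S \<subseteq> carrier V"
  shows "symmetric_subset G (gadget V W a b S)"
proof -
  have inv_mem: "inv\<^bsub>G\<^esub> x \<in> gadget V W a b S" if "x \<in> gadget V W a b S" for x
  proof -
    obtain v w where x: "x = (v, w)" by (cases x)
    have "v \<in> carrier V" "w \<in> carrier W" using that gadget_subset x by auto
    then show ?thesis using that unfolding x by (auto simp: gadget_def)
  qed
  have "set_inv\<^bsub>G\<^esub> (gadget V W a b S) = gadget V W a b S"
  proof (intro equalityI subsetI)
    fix x assume x: "x \<in> gadget V W a b S"
    then have "x = inv\<^bsub>G\<^esub> (inv\<^bsub>G\<^esub> x)" using gadget_subset by (metis G.inv_inv subsetD)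
    then show "x \<in> set_inv\<^bsub>G\<^esub> (gadget V W a b S)"
      using inv_mem[OF x] unfolding SET_INV_def by blast
  qed (auto simp: SET_INV_def inv_mem)
  then show ?thesis using gadget_subset by (simp add: symmetric_subset_def)
qed

text \<open>The map acts by \<phi> on \<open>V\<close> and fixes every coset of \<open>V\<close>.
  The full fibre imposes no condition, and the one-point fibres only ask whether two
  \<open>V\<close>-components are equal, which a bijection respects.\<close>

lemma cayley_iso_gadget:
  assumes S: "S \<subseteq> carrier V" and S': "S' \<subseteq> carrier V" and iso: "cayley_iso V S V S' \<phi>"
  shows "cayley_iso G (gadget V W a b S) G (gadget V W a b S') (map_prod \<phi> id)"
proof (rule cayley_isoI)
  have bij: "bij_betw \<phi> (carrier V) (carrier V)"
    and \<phi>: "\<And>g h. g \<in> carrier V \<Longrightarrow> h \<in> carrier V \<Longrightarrow>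
      h \<otimes>\<^bsub>V\<^esub> inv\<^bsub>V\<^esub> g \<in> S \<longleftrightarrow> \<phi> h \<otimes>\<^bsub>V\<^esub> inv\<^bsub>V\<^esub> (\<phi> g) \<in> S'"
    using iso unfolding cayley_iso_def by blast+
  show "bij_betw (map_prod \<phi> id) (carrier G) (carrier G)"
    using bij_betw_map_prod[OF bij bij_betw_id] by simp
  fix x y assume "x \<in> carrier G" "y \<in> carrier G"
  then obtain g u h w where x: "x = (g, u)" and y: "y = (h, w)"
    and c: "g \<in> carrier V" "u \<in> carrier W" "h \<in> carrier V" "w \<in> carrier W" by auto
  have \<phi>c: "\<phi> g \<in> carrier V" "\<phi> h \<in> carrier V" using c bij_betwE[OF bij] by auto
  have inv_diff: "inv\<^bsub>V\<^esub> (p \<otimes>\<^bsub>V\<^esub> inv\<^bsub>V\<^esub> q) = q \<otimes>\<^bsub>V\<^esub> inv\<^bsub>V\<^esub> p"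
    if "p \<in> carrier V" "q \<in> carrier V" for p q
    using that by (simp add: V.inv_mult_group)
  have diff_one: "p \<otimes>\<^bsub>V\<^esub> inv\<^bsub>V\<^esub> q = \<one>\<^bsub>V\<^esub> \<longleftrightarrow> p = q"
    if "p \<in> carrier V" "q \<in> carrier V" for p q
    using that by (metis V.inv_equality V.inv_inv V.inv_closed V.r_inv)
  have eq: "h = g \<longleftrightarrow> \<phi> h = \<phi> g"
    using c bij by (auto simp: bij_betw_def dest: inj_onD)
  show "y \<otimes>\<^bsub>G\<^esub> inv\<^bsub>G\<^esub> x \<in> gadget V W a b S \<longleftrightarrow>
      map_prod \<phi> id y \<otimes>\<^bsub>G\<^esub> inv\<^bsub>G\<^esub> (map_prod \<phi> id x) \<in> gadget V W a b S'"
    \<comment> \<open>The instance at \<open>g h\<close> settles the fibre over \<open>a\<close>;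
      the one at \<open>h g\<close> settles the fibre over its inverse, where arcs are
      reversed.\<close>
    unfolding x y using c \<phi>c \<phi>[of g h] \<phi>[of h g] eq
    by (simp add: mem_gadget_iff[OF S] mem_gadget_iff[OF S'] inv_diff diff_one)
qed

text \<open>Since \<alpha> preserves \<open>V\<close>, it permutes the cosets of \<open>V\<close>
  and matches the fibres of the two gadgets according to their sizes. Its restriction \<beta> to
  \<open>V\<close>, possibly followed by inversion, is the required automorphism.\<close>

lemma gadget_rigid:
  assumes S: "S \<subseteq> carrier V" and S': "S' \<subseteq> carrier V"
    and card: "card S = card S'" and two: "2 \<le> card S"
    and \<alpha>: "\<alpha> \<in> iso G G" and \<alpha>S: "\<alpha> ` gadget V W a b S = gadget V W a b S'"
    and \<alpha>V: "\<alpha> ` (carrier V \<times> {\<one>\<^bsub>W\<^esub>}) = carrier V \<times> {\<one>\<^bsub>W\<^esub>}"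
  shows "\<exists>\<beta>\<in>iso V V. \<beta> ` S = S'"
proof -
  interpret \<alpha>: group_hom G G \<alpha>
    using \<alpha> G.group_axioms by (simp add: group_hom_def group_hom_axioms_def iso_def)
  have inj: "inj_on \<alpha> (carrier G)" and surj: "\<alpha> ` carrier G = carrier G"
    using \<alpha> by (auto simp: iso_def bij_betw_def)
  define \<beta> where "\<beta> v = fst (\<alpha> (v, \<one>\<^bsub>W\<^esub>))" for v
  have \<beta>: "\<alpha> (v, \<one>\<^bsub>W\<^esub>) = (\<beta> v, \<one>\<^bsub>W\<^esub>)" "\<beta> v \<in> carrier V" if "v \<in> carrier V" for v
  proof -
    have "\<alpha> (v, \<one>\<^bsub>W\<^esub>) \<in> carrier V \<times> {\<one>\<^bsub>W\<^esub>}" using that \<alpha>V by blast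
    then show "\<alpha> (v, \<one>\<^bsub>W\<^esub>) = (\<beta> v, \<one>\<^bsub>W\<^esub>)" "\<beta> v \<in> carrier V"
      unfolding \<beta>_def by auto
  qed
  have \<beta>_hom: "\<beta> \<in> hom V V"
  proof (rule homI)
    fix x y assume xy: "x \<in> carrier V" "y \<in> carrier V"
    have "\<alpha> ((x, \<one>\<^bsub>W\<^esub>) \<otimes>\<^bsub>G\<^esub> (y, \<one>\<^bsub>W\<^esub>)) = \<alpha> (x, \<one>\<^bsub>W\<^esub>) \<otimes>\<^bsub>G\<^esub> \<alpha> (y, \<one>\<^bsub>W\<^esub>)"
      using xy by (intro \<alpha>.hom_mult) auto
    then show "\<beta> (x \<otimes>\<^bsub>V\<^esub> y) = \<beta> x \<otimes>\<^bsub>V\<^esub> \<beta> y" using xy by (simp add: \<beta>)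
  qed (rule \<beta>)
  have \<beta>_inj: "inj_on \<beta> (carrier V)"
  proof (rule inj_onI)
    fix x y assume xy: "x \<in> carrier V" "y \<in> carrier V" "\<beta> x = \<beta> y"
    then have "\<alpha> (x, \<one>\<^bsub>W\<^esub>) = \<alpha> (y, \<one>\<^bsub>W\<^esub>)" by (simp add: \<beta>)
    then show "x = y" using xy inj by (auto dest: inj_onD)
  qed
  have \<beta>_iso: "\<beta> \<in> iso V V"
    by (rule iso_groupI[OF V.group_axioms \<beta>_hom \<beta>_inj finite_V])
  \<comment> \<open>As (v, w) is the product of (v, 1) and (1, w), \<alpha> is determined by \<beta>
    and by the images of the elements (1, w).\<close>
  have split: "\<alpha> (v, w) = (\<beta> v \<otimes>\<^bsub>V\<^esub> fst (\<alpha> (\<one>\<^bsub>V\<^esub>, w)), snd (\<alpha> (\<one>\<^bsub>V\<^esub>, w)))"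
    and closed: "fst (\<alpha> (\<one>\<^bsub>V\<^esub>, w)) \<in> carrier V" "snd (\<alpha> (\<one>\<^bsub>V\<^esub>, w)) \<in> carrier W"
    if vw: "v \<in> carrier V" "w \<in> carrier W" for v w
  proof -
    have "\<alpha> (\<one>\<^bsub>V\<^esub>, w) \<in> carrier G" using vw by (intro \<alpha>.hom_closed) simp
    then show cl: "fst (\<alpha> (\<one>\<^bsub>V\<^esub>, w)) \<in> carrier V" "snd (\<alpha> (\<one>\<^bsub>V\<^esub>, w)) \<in> carrier W"
      by (auto simp: mem_Times_iff)
    have "\<alpha> ((v, \<one>\<^bsub>W\<^esub>) \<otimes>\<^bsub>G\<^esub> (\<one>\<^bsub>V\<^esub>, w)) = \<alpha> (v, \<one>\<^bsub>W\<^esub>) \<otimes>\<^bsub>G\<^esub> \<alpha> (\<one>\<^bsub>V\<^esub>, w)"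
      using vw by (intro \<alpha>.hom_mult) auto
    then show "\<alpha> (v, w) = (\<beta> v \<otimes>\<^bsub>V\<^esub> fst (\<alpha> (\<one>\<^bsub>V\<^esub>, w)), snd (\<alpha> (\<one>\<^bsub>V\<^esub>, w)))"
      using vw cl by (simp add: \<beta> mult_DirProd')
  qed
  have fibre_ne_one: "snd (\<alpha> (\<one>\<^bsub>V\<^esub>, w)) \<noteq> \<one>\<^bsub>W\<^esub>" if w: "w \<in> carrier W" "w \<noteq> \<one>\<^bsub>W\<^esub>" for w
  proof
    assume "snd (\<alpha> (\<one>\<^bsub>V\<^esub>, w)) = \<one>\<^bsub>W\<^esub>"
    then have "\<alpha> (\<one>\<^bsub>V\<^esub>, w) \<in> \<alpha> ` (carrier V \<times> {\<one>\<^bsub>W\<^esub>})"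
      using closed(1)[of "\<one>\<^bsub>V\<^esub>" w] w \<alpha>V by (simp add: mem_Times_iff)
    then obtain x where x: "x \<in> carrier V \<times> {\<one>\<^bsub>W\<^esub>}" "\<alpha> (\<one>\<^bsub>V\<^esub>, w) = \<alpha> x" by blast
    have "(\<one>\<^bsub>V\<^esub>, w) = x" by (rule inj_onD[OF inj x(2)]) (use x(1) w in auto)
    then show False using w x(1) by blast
  qed
  text \<open>The fibres over \<open>a\<close> and \<open>inv a\<close> have \<open>card S \<ge> 2\<close> elements, those over \<open>b\<close> and \<open>c\<close> only one.\<close>
  have thin: "\<exists>w'\<in>{b, inv\<^bsub>W\<^esub> b, c, inv\<^bsub>W\<^esub> c}. \<alpha> (\<one>\<^bsub>V\<^esub>, w) = (\<one>\<^bsub>V\<^esub>, w')" if w: "w \<in> {b, c}" for w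
  proof -
    have wW: "w \<in> carrier W" and w1: "w \<noteq> \<one>\<^bsub>W\<^esub>" and wa: "w \<noteq> a" "w \<noteq> inv\<^bsub>W\<^esub> a"
      using w fibres_distinct by auto
    have mem: "(\<one>\<^bsub>V\<^esub>, w) \<in> gadget V W a b S" using w by (auto simp: gadget_def)
    obtain x y where xy: "\<alpha> (\<one>\<^bsub>V\<^esub>, w) = (x, y)" by fastforce
    have x: "x \<in> carrier V" "y \<in> carrier W" using closed[of "\<one>\<^bsub>V\<^esub>" w] xy wW by auto
    have xy': "(x, y) \<in> gadget V W a b S'" using imageI[OF mem, of \<alpha>] \<alpha>S xy by simp
    \<comment> \<open>The fibre over \<open>y\<close> has only the point \<open>x\<close>: another
      point \<open>v\<close> would differ from \<open>x\<close> by \<beta> u for some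
      \<open>u\<close> in \<open>V\<close>, and pulling back would put (u, w) into the gadget of
      \<open>S\<close>, whose fibre over \<open>w\<close> contains only the identity.\<close>
    have "v = x" if v: "(v, y) \<in> gadget V W a b S'" for v
    proof -
      have "(v, y) \<in> \<alpha> ` gadget V W a b S" using v \<alpha>S by simp
      then obtain s t where st: "(s, t) \<in> gadget V W a b S" "\<alpha> (s, t) = (v, y)" by auto
      have stc: "s \<in> carrier V" "t \<in> carrier W" using st(1) gadget_subset by auto
      have "v \<in> carrier V" using v by (auto simp: gadget_def)
      then have "v \<otimes>\<^bsub>V\<^esub> inv\<^bsub>V\<^esub> x \<in> carrier V" using x by simp
      then have "(v \<otimes>\<^bsub>V\<^esub> inv\<^bsub>V\<^esub> x, \<one>\<^bsub>W\<^esub>) \<in> \<alpha> ` (carrier V \<times> {\<one>\<^bsub>W\<^esub>})"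
        unfolding \<alpha>V by simp
      then obtain u where u: "u \<in> carrier V" "\<alpha> (u, \<one>\<^bsub>W\<^esub>) = (v \<otimes>\<^bsub>V\<^esub> inv\<^bsub>V\<^esub> x, \<one>\<^bsub>W\<^esub>)"
        by fastforce
      have "\<alpha> (u, w) = (\<beta> u \<otimes>\<^bsub>V\<^esub> x, y)" using split[of u w] u wW xy by simp
      also have "\<beta> u = v \<otimes>\<^bsub>V\<^esub> inv\<^bsub>V\<^esub> x" using \<beta>(1)[OF u(1)] u(2) by simp
      finally have "\<alpha> (u, w) = \<alpha> (s, t)"
        using st(2) x \<open>v \<in> carrier V\<close> by (simp add: V.m_assoc)
      then have "(u, w) = (s, t)" by (rule inj_onD[OF inj]) (use u stc wW in auto)
      then have "(u, w) \<in> gadget V W a b S" using st by simp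
      then have "u = \<one>\<^bsub>V\<^esub>" using w1 wa by (auto simp: gadget_def)
      then show "v = x" using st(2) xy \<open>(u, w) = (s, t)\<close> by simp
    qed
    then have sub: "{v. (v, y) \<in> gadget V W a b S'} \<subseteq> {x}" by blast
    have y1: "y \<noteq> \<one>\<^bsub>W\<^esub>" using fibre_ne_one[OF wW w1] xy by simp
    have "y \<noteq> a"
    proof
      assume "y = a"
      then have "S' \<subseteq> {x}" using sub S' by (auto simp: gadget_def)
      then show False using two card card_mono[of "{x}" S'] by simp
    qed
    moreover have "y \<noteq> inv\<^bsub>W\<^esub> a"
    proof
      assume "y = inv\<^bsub>W\<^esub> a"
      then have "(\<lambda>v. inv\<^bsub>V\<^esub> v) ` S' \<subseteq> {x}" using sub S' by (auto simp: gadget_def subset_iff)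
      then have "S' \<subseteq> {inv\<^bsub>V\<^esub> x}"
        using S' V.inv_inv by (fastforce simp: image_subset_iff)
      then show False using two card card_mono[of "{inv\<^bsub>V\<^esub> x}" S'] by simp
    qed
    ultimately show ?thesis using xy' xy y1 by (auto simp: gadget_def)
  qed
  \<comment> \<open>Here both markers are needed: (1, a) times (1, b) is (1, c), and the images of
    (1, b) and (1, c) have trivial \<open>V\<close>-component by \<open>thin\<close>.\<close>
  have \<alpha>a: "fst (\<alpha> (\<one>\<^bsub>V\<^esub>, a)) = \<one>\<^bsub>V\<^esub>"
  proof -
    have "\<alpha> ((\<one>\<^bsub>V\<^esub>, a) \<otimes>\<^bsub>G\<^esub> (\<one>\<^bsub>V\<^esub>, b)) = \<alpha> (\<one>\<^bsub>V\<^esub>, a) \<otimes>\<^bsub>G\<^esub> \<alpha> (\<one>\<^bsub>V\<^esub>, b)"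
      by (intro \<alpha>.hom_mult) auto
    then have "fst (\<alpha> (\<one>\<^bsub>V\<^esub>, a)) \<otimes>\<^bsub>V\<^esub> \<one>\<^bsub>V\<^esub> = \<one>\<^bsub>V\<^esub>"
      using thin[of b] thin[of c] by (auto simp: mult_DirProd')
    then show ?thesis using closed(1)[of "\<one>\<^bsub>V\<^esub>" a] by simp
  qed
  define y where "y = snd (\<alpha> (\<one>\<^bsub>V\<^esub>, a))"
  have \<alpha>s: "\<alpha> (s, a) = (\<beta> s, y)" if "s \<in> carrier V" for s
    using split[of s a] \<alpha>a that \<beta>(2)[OF that] by (simp add: y_def)
  have img: "(\<beta> s, y) \<in> gadget V W a b S'" if "s \<in> S" for s
  proof -
    have "(s, a) \<in> gadget V W a b S" using that S by (auto simp: gadget_def)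
    then have "\<alpha> (s, a) \<in> gadget V W a b S'" using \<alpha>S by blast
    then show ?thesis using \<alpha>s S that by auto
  qed
  have y1: "y \<noteq> \<one>\<^bsub>W\<^esub>" using fibre_ne_one[of a] fibres_distinct by (simp add: y_def)
  have fin: "finite S'" using S' by (rule finite_subset) simp
  have inj_S: "inj_on \<beta> S" using \<beta>_inj S by (rule inj_on_subset)
  \<comment> \<open>Over any other nontrivial \<open>y\<close> the gadget has at most one point, too
    little room for the injective image of the at least two elements of \<open>S\<close>.\<close>
  have "y \<in> {a, inv\<^bsub>W\<^esub> a}"
  proof (rule ccontr)
    assume "y \<notin> {a, inv\<^bsub>W\<^esub> a}"
    then have "\<beta> ` S \<subseteq> {\<one>\<^bsub>V\<^esub>}" using img y1 by (force simp: gadget_def)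
    then have "card (\<beta> ` S) \<le> 1" using card_mono[of "{\<one>\<^bsub>V\<^esub>}" "\<beta> ` S"] by simp
    then show False using two by (simp add: card_image[OF inj_S])
  qed
  then consider "y = a" | "y = inv\<^bsub>W\<^esub> a" by blast
  then show ?thesis
  proof cases
    case 1
    have "\<beta> ` S \<subseteq> S'" using img fibres_distinct unfolding 1 by (auto simp: gadget_def)
    then have "\<beta> ` S = S'" using fin card by (intro card_subset_eq) (simp_all add: card_image[OF inj_S])
    then show ?thesis using \<beta>_iso by blast
  next
    case 2
    \<comment> \<open>When \<alpha> sends the fibre over \<open>a\<close> to the fibre over its
      inverse, \<beta> maps \<open>S\<close> to the inverses of \<open>S'\<close>. Inversion
      corrects this, being an automorphism because \<open>V\<close> is commutative.\<close>
    have inv_iso: "(\<lambda>v. inv\<^bsub>V\<^esub> v) \<in> iso V V"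
      by (rule iso_groupI[OF V.group_axioms _ V.inv_inj finite_V]) (auto simp: hom_def V.inv_mult)
    have "(\<lambda>v. inv\<^bsub>V\<^esub> (\<beta> v)) ` S \<subseteq> S'"
      using img fibres_distinct unfolding 2 by (auto simp: gadget_def)
    moreover have "inj_on (\<lambda>v. inv\<^bsub>V\<^esub> (\<beta> v)) S"
      using comp_inj_on[OF inj_S inj_on_subset[OF V.inv_inj, of "\<beta> ` S"]] \<beta>(2) S
      by (auto simp: comp_def)
    ultimately have "(\<lambda>v. inv\<^bsub>V\<^esub> (\<beta> v)) ` S = S'"
      using fin card by (intro card_subset_eq) (simp_all add: card_image)
    moreover have "(\<lambda>v. inv\<^bsub>V\<^esub> (\<beta> v)) \<in> iso V V"
      using iso_set_trans[OF \<beta>_iso inv_iso] by (simp add: comp_def)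
    ultimately show ?thesis by blast
  qed
qed

section \<open>Criteria for automorphisms to preserve V\<close>

abbreviation "fibres \<equiv> {\<one>\<^bsub>W\<^esub>, a, inv\<^bsub>W\<^esub> a, b, inv\<^bsub>W\<^esub> b, c, inv\<^bsub>W\<^esub> c}"

lemma snd_gadget: "x \<in> gadget V W a b S \<Longrightarrow> snd x \<in> fibres"
  by (auto simp: gadget_def)

lemma gadget_V: "carrier V \<times> {\<one>\<^bsub>W\<^esub>} \<subseteq> gadget V W a b S"
  by (auto simp: gadget_def)

lemma iso_image_V_eqI:
  assumes \<alpha>: "\<alpha> \<in> iso G G" and sub: "\<alpha> ` (carrier V \<times> {\<one>\<^bsub>W\<^esub>}) \<subseteq> carrier V \<times> {\<one>\<^bsub>W\<^esub>}"
  shows "\<alpha> ` (carrier V \<times> {\<one>\<^bsub>W\<^esub>}) = carrier V \<times> {\<one>\<^bsub>W\<^esub>}"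
proof -
  have "inj_on \<alpha> (carrier G)" using \<alpha> by (simp add: iso_def bij_betw_def)
  then have "inj_on \<alpha> (carrier V \<times> {\<one>\<^bsub>W\<^esub>})" by (rule inj_on_subset) auto
  then show ?thesis using sub by (intro endo_inj_surj) auto
qed

text \<open>The square of an element of V x 1 is again in V x 1, hence in the gadget. Its image then
  has both itself and its square in the gadget, which by \<open>no_squares\<close> is possible only
  over the identity of \<open>W\<close>.\<close>

lemma gadget_iso_image_V:
  assumes no_squares: "\<And>w. w \<in> fibres \<Longrightarrow> w \<otimes>\<^bsub>W\<^esub> w \<in> fibres \<Longrightarrow> w = \<one>\<^bsub>W\<^esub>"
    and \<alpha>: "\<alpha> \<in> iso G G" and \<alpha>S: "\<alpha> ` gadget V W a b S = gadget V W a b S'"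
  shows "\<alpha> ` (carrier V \<times> {\<one>\<^bsub>W\<^esub>}) = carrier V \<times> {\<one>\<^bsub>W\<^esub>}"
proof (rule iso_image_V_eqI[OF \<alpha>], rule image_subsetI)
  interpret \<alpha>: group_hom G G \<alpha>
    using \<alpha> G.group_axioms by (simp add: group_hom_def group_hom_axioms_def iso_def)
  fix x assume x: "x \<in> carrier V \<times> {\<one>\<^bsub>W\<^esub>}"
  then have xG: "x \<in> carrier G" by auto
  have "x \<otimes>\<^bsub>G\<^esub> x \<in> carrier V \<times> {\<one>\<^bsub>W\<^esub>}" using x by auto
  then have "\<alpha> (x \<otimes>\<^bsub>G\<^esub> x) \<in> gadget V W a b S'" and "\<alpha> x \<in> gadget V W a b S'"
    unfolding \<alpha>S[symmetric] using x by (auto intro!: imageI subsetD[OF gadget_V])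
  then have mem: "\<alpha> x \<in> gadget V W a b S'" "\<alpha> x \<otimes>\<^bsub>G\<^esub> \<alpha> x \<in> gadget V W a b S'"
    using xG by simp_all
  have "snd (\<alpha> x) = \<one>\<^bsub>W\<^esub>"
    using no_squares[OF snd_gadget[OF mem(1)]] snd_gadget[OF mem(2)] by (simp add: mult_DirProd')
  moreover have "\<alpha> x \<in> carrier G" using xG by (rule \<alpha>.hom_closed)
  ultimately show "\<alpha> x \<in> carrier V \<times> {\<one>\<^bsub>W\<^esub>}" by (auto simp: mem_Times_iff)
qed

text \<open>Serves p = 3, where the square of \<open>a\<close> is its inverse and the criterion by
  squares fails. The image \<open>H\<close> of V x 1 is a subgroup of order |V| inside the gadget;
  if it left V x 1, it would have at most 7 or at most 3 |S'| elements.\<close>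

lemma gadget_iso_image_V_small:
  assumes S': "S' \<subseteq> carrier V" and small: "3 * card S' < card (carrier V)" "7 < card (carrier V)"
    and \<alpha>: "\<alpha> \<in> iso G G" and \<alpha>S: "\<alpha> ` gadget V W a b S = gadget V W a b S'"
  shows "\<alpha> ` (carrier V \<times> {\<one>\<^bsub>W\<^esub>}) = carrier V \<times> {\<one>\<^bsub>W\<^esub>}"
proof (rule ccontr)
  interpret \<alpha>: group_hom G G \<alpha>
    using \<alpha> G.group_axioms by (simp add: group_hom_def group_hom_axioms_def iso_def)
  define H where "H = \<alpha> ` (carrier V \<times> {\<one>\<^bsub>W\<^esub>})"
  assume "\<alpha> ` (carrier V \<times> {\<one>\<^bsub>W\<^esub>}) \<noteq> carrier V \<times> {\<one>\<^bsub>W\<^esub>}"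
  then have "\<not> H \<subseteq> carrier V \<times> {\<one>\<^bsub>W\<^esub>}" using iso_image_V_eqI[OF \<alpha>] unfolding H_def by blast
  then obtain h where h: "h \<in> H" "h \<notin> carrier V \<times> {\<one>\<^bsub>W\<^esub>}" by blast
  have HT: "H \<subseteq> gadget V W a b S'" unfolding H_def using gadget_V[of S] \<alpha>S by blast
  have HG: "H \<subseteq> carrier G" using HT gadget_subset by blast
  have mult: "x \<otimes>\<^bsub>G\<^esub> y \<in> H" if xy: "x \<in> H" "y \<in> H" for x y
  proof -
    obtain v w where "v \<in> carrier V" "w \<in> carrier V" and
      eq: "x = \<alpha> (v, \<one>\<^bsub>W\<^esub>)" "y = \<alpha> (w, \<one>\<^bsub>W\<^esub>)" using xy unfolding H_def by blast
    then have "x \<otimes>\<^bsub>G\<^esub> y = \<alpha> (v \<otimes>\<^bsub>V\<^esub> w, \<one>\<^bsub>W\<^esub>)" "v \<otimes>\<^bsub>V\<^esub> w \<in> carrier V"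
      using \<alpha>.hom_mult[of "(v, \<one>\<^bsub>W\<^esub>)" "(w, \<one>\<^bsub>W\<^esub>)"] by simp_all
    then show ?thesis unfolding H_def by blast
  qed
  have inv: "inv\<^bsub>G\<^esub> x \<in> H" if x: "x \<in> H" for x
  proof -
    obtain v where v: "v \<in> carrier V" and eq: "x = \<alpha> (v, \<one>\<^bsub>W\<^esub>)" using x unfolding H_def by blast
    then have "inv\<^bsub>G\<^esub> x = \<alpha> (inv\<^bsub>V\<^esub> v, \<one>\<^bsub>W\<^esub>)"
      using \<alpha>.hom_inv[of "(v, \<one>\<^bsub>W\<^esub>)"] by simp
    then show ?thesis using v unfolding H_def by blast
  qed
  have "inj_on \<alpha> (carrier G)" using \<alpha> by (simp add: iso_def bij_betw_def)
  then have "inj_on \<alpha> (carrier V \<times> {\<one>\<^bsub>W\<^esub>})" by (rule inj_on_subset) auto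
  then have cardH: "card H = card (carrier V)"
    unfolding H_def by (simp add: card_image card_cartesian_product)
  have finH: "finite H" unfolding H_def by simp
  show False
  proof (cases "\<exists>k\<in>H. snd k \<notin> {\<one>\<^bsub>W\<^esub>, a, inv\<^bsub>W\<^esub> a}")
    case True
    then obtain k where k: "k \<in> H" "snd k \<notin> {\<one>\<^bsub>W\<^esub>, a, inv\<^bsub>W\<^esub> a}" by blast
    \<comment> \<open>\<open>H\<close> meets a one-point fibre in \<open>k\<close>. Two elements of
      \<open>H\<close> with the same \<open>W\<close>-component have a quotient in V x 1;
      multiplying \<open>k\<close> by it stays in \<open>H\<close> and in that fibre, so the
      quotient is trivial and \<open>H\<close> embeds into the seven elements of
      \<open>fibres\<close>.\<close>
    have thin: "fst x = \<one>\<^bsub>V\<^esub>" if "x \<in> H" "snd x = snd k" for x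
      using that k HT by (cases x) (auto simp: gadget_def)
    have "inj_on snd H"
    proof (rule inj_onI)
      fix x y assume xy: "x \<in> H" "y \<in> H" "snd x = snd y"
      have cl: "fst x \<in> carrier V" "snd x \<in> carrier W" "fst y \<in> carrier V" "snd y \<in> carrier W"
        "fst k \<in> carrier V" "snd k \<in> carrier W"
        using xy k HG by (auto simp: mem_Times_iff)
      define z where "z = x \<otimes>\<^bsub>G\<^esub> inv\<^bsub>G\<^esub> y"
      have z: "z = (fst x \<otimes>\<^bsub>V\<^esub> inv\<^bsub>V\<^esub> (fst y), \<one>\<^bsub>W\<^esub>)"
        unfolding z_def using inv_G[of "fst y" "snd y"] cl xy(3) by (simp add: mult_DirProd')
      have "z \<otimes>\<^bsub>G\<^esub> k \<in> H" unfolding z_def using xy k by (intro mult inv)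
      then have "fst z \<otimes>\<^bsub>V\<^esub> fst k = \<one>\<^bsub>V\<^esub>"
        using thin[of "z \<otimes>\<^bsub>G\<^esub> k"] cl by (simp add: mult_DirProd' z)
      then have "fst x \<otimes>\<^bsub>V\<^esub> inv\<^bsub>V\<^esub> (fst y) = \<one>\<^bsub>V\<^esub>" using thin[OF k(1)] cl by (simp add: z)
      then have "fst x = fst y" using cl by (metis V.inv_closed V.inv_equality V.inv_inv)
      then show "x = y" using xy(3) by (simp add: prod_eq_iff)
    qed
    then have "card H = card (snd ` H)" by (simp add: card_image)
    also have "\<dots> \<le> card fibres"
      using HT snd_gadget by (intro card_mono) auto
    also have "\<dots> \<le> length [\<one>\<^bsub>W\<^esub>, a, inv\<^bsub>W\<^esub> a, b, inv\<^bsub>W\<^esub> b, c, inv\<^bsub>W\<^esub> c]"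
      using card_length[of "[\<one>\<^bsub>W\<^esub>, a, inv\<^bsub>W\<^esub> a, b, inv\<^bsub>W\<^esub> b, c, inv\<^bsub>W\<^esub> c]"] by simp
    finally show False using small cardH by simp
  next
    case False
    have "snd h \<noteq> \<one>\<^bsub>W\<^esub>" using h HG by (auto simp: mem_Times_iff)
    then have snd_h: "snd h \<in> {a, inv\<^bsub>W\<^esub> a}" using False h(1) by blast
    \<comment> \<open>Now \<open>H\<close> lies over the identity, \<open>a\<close> and the inverse
      of \<open>a\<close>. Either \<open>h\<close> or its inverse lies over
      \<open>a\<close>.\<close>
    obtain k where k: "k \<in> H" "snd k = a"
    proof (cases "snd h = a")
      case False
      then have "snd h = inv\<^bsub>W\<^esub> a" using snd_h by blast
      moreover have "h = (fst h, snd h)" "fst h \<in> carrier V" using h HG by auto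
      ultimately have "snd (inv\<^bsub>G\<^esub> h) = a" by (metis W.inv_closed W.inv_inv a inv_G snd_conv)
      then show ?thesis using that inv h by blast
    qed (use that h in blast)
    have kV: "fst k \<in> carrier V" using k HG by auto
    have a_ne: "a \<noteq> \<one>\<^bsub>W\<^esub>" "inv\<^bsub>W\<^esub> a \<noteq> \<one>\<^bsub>W\<^esub>" "a \<noteq> inv\<^bsub>W\<^esub> a" "a \<notin> {b, inv\<^bsub>W\<^esub> b, c, inv\<^bsub>W\<^esub> c}"
      "inv\<^bsub>W\<^esub> a \<notin> {b, inv\<^bsub>W\<^esub> b, c, inv\<^bsub>W\<^esub> c}"
      using fibres_distinct by auto
    have over_a: "v \<in> S'" if "(v, a) \<in> H" for v
      using subsetD[OF HT that] a_ne by (auto simp: gadget_def)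
    have over_inv_a: "inv\<^bsub>V\<^esub> v \<in> S'" if "(v, inv\<^bsub>W\<^esub> a) \<in> H" for v
      using subsetD[OF HT that] a_ne by (auto simp: gadget_def)
    have finS': "finite S'" using S' by (rule finite_subset) simp
    define K where "K = {v \<in> carrier V. (v, \<one>\<^bsub>W\<^esub>) \<in> H}"
    \<comment> \<open>Multiplication by \<open>k\<close> moves the part of \<open>H\<close> over the
      identity into the fibre over \<open>a\<close>, so this part too has at most |S'| elements,
      although the gadget contains all of \<open>V\<close> there.\<close>
    have "(\<lambda>v. v \<otimes>\<^bsub>V\<^esub> fst k) ` K \<subseteq> S'"
    proof (rule image_subsetI)
      fix v assume v: "v \<in> K"
      then have "(v, \<one>\<^bsub>W\<^esub>) \<otimes>\<^bsub>G\<^esub> k \<in> H" using k by (intro mult) (simp_all add: K_def)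
      then show "v \<otimes>\<^bsub>V\<^esub> fst k \<in> S'" using k by (intro over_a) (simp add: mult_DirProd')
    qed
    moreover have "inj_on (\<lambda>v. v \<otimes>\<^bsub>V\<^esub> fst k) K" using kV by (auto simp: inj_on_def K_def)
    ultimately have cardK: "card K \<le> card S'" using finS' by (metis card_image card_mono)
    have "H \<subseteq> K \<times> {\<one>\<^bsub>W\<^esub>} \<union> S' \<times> {a} \<union> (\<lambda>v. inv\<^bsub>V\<^esub> v) ` S' \<times> {inv\<^bsub>W\<^esub> a}"
    proof
      fix x assume x: "x \<in> H"
      obtain v w where vw: "x = (v, w)" by (cases x)
      have v: "v \<in> carrier V" and w: "w \<in> {\<one>\<^bsub>W\<^esub>, a, inv\<^bsub>W\<^esub> a}" using x vw HG False by auto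
      have "v \<in> (\<lambda>v. inv\<^bsub>V\<^esub> v) ` S'" if "w = inv\<^bsub>W\<^esub> a"
        using over_inv_a[of v] that x vw v V.inv_inv[OF v] by (metis imageI)
      then show "x \<in> K \<times> {\<one>\<^bsub>W\<^esub>} \<union> S' \<times> {a} \<union> (\<lambda>v. inv\<^bsub>V\<^esub> v) ` S' \<times> {inv\<^bsub>W\<^esub> a}"
        using w x v over_a[of v] unfolding vw K_def by blast
    qed
    then have "card H \<le> card (K \<times> {\<one>\<^bsub>W\<^esub>} \<union> S' \<times> {a} \<union> (\<lambda>v. inv\<^bsub>V\<^esub> v) ` S' \<times> {inv\<^bsub>W\<^esub> a})"
      using finS' by (intro card_mono) (auto simp: K_def)
    also have "\<dots> \<le> card (K \<times> {\<one>\<^bsub>W\<^esub>} \<union> S' \<times> {a}) + card ((\<lambda>v. inv\<^bsub>V\<^esub> v) ` S' \<times> {inv\<^bsub>W\<^esub> a})"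
      by (rule card_Un_le)
    also have "\<dots> \<le> card (K \<times> {\<one>\<^bsub>W\<^esub>}) + card (S' \<times> {a}) + card ((\<lambda>v. inv\<^bsub>V\<^esub> v) ` S' \<times> {inv\<^bsub>W\<^esub> a})"
      by (intro add_right_mono card_Un_le)
    also have "\<dots> \<le> card S' + card S' + card S'"
      using cardK card_image_le[OF finS', of "\<lambda>v. inv\<^bsub>V\<^esub> v"]
      by (simp add: card_cartesian_product)
    finally show False using small cardH by simp
  qed
qed

end

section \<open>Groups of exponent two\<close>

text \<open>Every element of \<open>V\<close> is its own inverse, so S x 1 is already symmetric. Its
  Cayley graph consists of disjoint copies of that of \<open>S\<close>, one over each element of
  \<open>W\<close>, and \<phi> is applied in each copy.\<close>

lemma not_CI_group_exponent_2:
  assumes V: "group V" and W: "group W" and H: "group H"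
    and fin: "finite (carrier V)"
    and exp2: "\<And>v. v \<in> carrier V \<Longrightarrow> v \<otimes>\<^bsub>V\<^esub> v = \<one>\<^bsub>V\<^esub>"
    and \<psi>: "\<psi> \<in> iso (V \<times>\<times> W) H"
    and S: "S \<subseteq> carrier V" and S': "S' \<subseteq> carrier V" and iso: "cayley_iso V S V S' \<phi>"
    and gen: "generate V S = carrier V"
    and no_iso: "\<And>\<beta>. \<beta> \<in> iso V V \<Longrightarrow> \<beta> ` S \<noteq> S'"
  shows "\<not> is_CI_group H"
proof -
  interpret V: group V by fact
  interpret W: group W by fact
  interpret G: group "V \<times>\<times> W" by (intro DirProd_group V W)
  have inv_self: "inv\<^bsub>V\<^esub> v = v" if "v \<in> carrier V" for v
    using that exp2 by (intro V.inv_equality) auto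
  have sym: "symmetric_subset (V \<times>\<times> W) (X \<times> {\<one>\<^bsub>W\<^esub>})" if X: "X \<subseteq> carrier V" for X
  proof -
    have "inv\<^bsub>V \<times>\<times> W\<^esub> x = x" if "x \<in> X \<times> {\<one>\<^bsub>W\<^esub>}" for x
      using that X inv_self by (auto simp: inv_DirProd[OF V W])
    then have "set_inv\<^bsub>V \<times>\<times> W\<^esub> (X \<times> {\<one>\<^bsub>W\<^esub>}) = (\<Union>x\<in>X \<times> {\<one>\<^bsub>W\<^esub>}. {x})"
      unfolding SET_INV_def by (intro SUP_cong) simp_all
    then have "set_inv\<^bsub>V \<times>\<times> W\<^esub> (X \<times> {\<one>\<^bsub>W\<^esub>}) = X \<times> {\<one>\<^bsub>W\<^esub>}" by simp
    moreover have "X \<times> {\<one>\<^bsub>W\<^esub>} \<subseteq> carrier (V \<times>\<times> W)" using X by auto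
    ultimately show ?thesis by (simp add: symmetric_subset_def)
  qed
  have iso': "cayley_iso (V \<times>\<times> W) (S \<times> {\<one>\<^bsub>W\<^esub>}) (V \<times>\<times> W) (S' \<times> {\<one>\<^bsub>W\<^esub>}) (map_prod \<phi> id)"
  proof (rule cayley_isoI)
    have bij: "bij_betw \<phi> (carrier V) (carrier V)" using iso unfolding cayley_iso_def by blast
    then show "bij_betw (map_prod \<phi> id) (carrier (V \<times>\<times> W)) (carrier (V \<times>\<times> W))"
      using bij_betw_map_prod[OF bij bij_betw_id] by simp
    fix x y assume xy: "x \<in> carrier (V \<times>\<times> W)" "y \<in> carrier (V \<times>\<times> W)"
    show "y \<otimes>\<^bsub>V \<times>\<times> W\<^esub> inv\<^bsub>V \<times>\<times> W\<^esub> x \<in> S \<times> {\<one>\<^bsub>W\<^esub>} \<longleftrightarrow>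
      map_prod \<phi> id y \<otimes>\<^bsub>V \<times>\<times> W\<^esub> inv\<^bsub>V \<times>\<times> W\<^esub> (map_prod \<phi> id x) \<in> S' \<times> {\<one>\<^bsub>W\<^esub>}"
      using xy iso bij_betwE[OF bij]
      by (auto simp: cayley_iso_def inv_DirProd[OF V W])
  qed
  show ?thesis
  proof (rule not_CI_groupI[OF G.group_axioms H \<psi> sym[OF S] sym[OF S'] iso'])
    fix \<alpha> assume \<alpha>: "\<alpha> \<in> iso (V \<times>\<times> W) (V \<times>\<times> W)"
    show "\<alpha> ` (S \<times> {\<one>\<^bsub>W\<^esub>}) \<noteq> S' \<times> {\<one>\<^bsub>W\<^esub>}"
    proof
      assume \<alpha>S: "\<alpha> ` (S \<times> {\<one>\<^bsub>W\<^esub>}) = S' \<times> {\<one>\<^bsub>W\<^esub>}"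
      interpret \<alpha>: group_hom "V \<times>\<times> W" "V \<times>\<times> W" \<alpha>
        using \<alpha> G.group_axioms by (simp add: group_hom_def group_hom_axioms_def iso_def)
      have inj: "inj_on \<alpha> (carrier (V \<times>\<times> W))" using \<alpha> by (simp add: iso_def bij_betw_def)
      have mult: "\<alpha> (v \<otimes>\<^bsub>V\<^esub> v', \<one>\<^bsub>W\<^esub>) = \<alpha> (v, \<one>\<^bsub>W\<^esub>) \<otimes>\<^bsub>V \<times>\<times> W\<^esub> \<alpha> (v', \<one>\<^bsub>W\<^esub>)"
        if "v \<in> carrier V" "v' \<in> carrier V" for v v'
        using that \<alpha>.hom_mult[of "(v, \<one>\<^bsub>W\<^esub>)" "(v', \<one>\<^bsub>W\<^esub>)"] by simp
      \<comment> \<open>This is what the generation hypothesis is for: \<alpha> maps S x 1 into V x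
        1, hence also everything generated by it.\<close>
      have inV: "\<alpha> (v, \<one>\<^bsub>W\<^esub>) \<in> carrier V \<times> {\<one>\<^bsub>W\<^esub>}" if "v \<in> generate V S" for v
        using that
      proof induction
        case one
        then show ?case using \<alpha>.hom_one by simp
      next
        case (incl v)
        then have "\<alpha> (v, \<one>\<^bsub>W\<^esub>) \<in> S' \<times> {\<one>\<^bsub>W\<^esub>}" using \<alpha>S by blast
        then show ?case using S' by auto
      next
        case (inv v)
        then have "inv\<^bsub>V\<^esub> v = v" using S inv_self by blast
        moreover have "\<alpha> (v, \<one>\<^bsub>W\<^esub>) \<in> S' \<times> {\<one>\<^bsub>W\<^esub>}" using inv \<alpha>S by blast
        ultimately show ?case using S' by auto
      next
        case (eng v v')
        then have "v \<in> carrier V" "v' \<in> carrier V" using gen by auto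
        then show ?case using eng.IH by (auto simp: mult)
      qed
      define \<beta> where "\<beta> v = fst (\<alpha> (v, \<one>\<^bsub>W\<^esub>))" for v
      have \<beta>: "\<alpha> (v, \<one>\<^bsub>W\<^esub>) = (\<beta> v, \<one>\<^bsub>W\<^esub>)" "\<beta> v \<in> carrier V" if "v \<in> carrier V" for v
      proof -
        have "\<alpha> (v, \<one>\<^bsub>W\<^esub>) \<in> carrier V \<times> {\<one>\<^bsub>W\<^esub>}" using that gen inV by simp
        then show "\<alpha> (v, \<one>\<^bsub>W\<^esub>) = (\<beta> v, \<one>\<^bsub>W\<^esub>)" "\<beta> v \<in> carrier V"
          unfolding \<beta>_def by (auto simp: mem_Times_iff prod_eq_iff)
      qed
      have "\<beta> \<in> iso V V"
      proof (rule iso_groupI[OF V _ _ fin])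
        show "\<beta> \<in> hom V V" using mult by (intro homI) (simp_all add: \<beta>)
        show "inj_on \<beta> (carrier V)"
        proof (rule inj_onI)
          fix x y assume xy: "x \<in> carrier V" "y \<in> carrier V" "\<beta> x = \<beta> y"
          then have "\<alpha> (x, \<one>\<^bsub>W\<^esub>) = \<alpha> (y, \<one>\<^bsub>W\<^esub>)" by (simp add: \<beta>)
          then have "(x, \<one>\<^bsub>W\<^esub>) = (y, \<one>\<^bsub>W\<^esub>)" by (rule inj_onD[OF inj]) (use xy in auto)
          then show "x = y" by simp
        qed
      qed
      moreover have "\<beta> ` S = S'"
      proof -
        have "\<beta> ` S = fst ` \<alpha> ` (S \<times> {\<one>\<^bsub>W\<^esub>})" by (force simp: \<beta>_def image_iff)
        also have "\<dots> = S'" unfolding \<alpha>S by force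
        finally show ?thesis .
      qed
      ultimately show False using no_iso by blast
    qed
  qed
qed

text \<open>Everything outside the subgroup generated by \<open>S\<close> lies in the complement of
  \<open>S\<close>. With a fixed \<open>x\<close> outside, each \<open>y\<close> inside is the
  quotient of x y and \<open>x\<close>, both of which are outside.\<close>

lemma (in group) generate_complement:
  assumes S: "S \<subseteq> carrier G" and gen: "generate G S \<noteq> carrier G"
  shows "generate G (carrier G - S) = carrier G"
proof -
  have sub: "subgroup (generate G S) G" by (rule generate_is_subgroup[OF S])
  obtain x where x: "x \<in> carrier G" "x \<notin> generate G S"
    using gen generate_incl[OF S] by blast
  have out: "y \<in> generate G (carrier G - S)" if "y \<in> carrier G" "y \<notin> generate G S" for y
    using that by (intro generate.incl) (auto intro: generate.incl)
  have "y \<in> generate G (carrier G - S)" if y: "y \<in> carrier G" for y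
  proof (cases "y \<in> generate G S")
    case True
    have "x \<otimes> y \<notin> generate G S"
    proof
      assume "x \<otimes> y \<in> generate G S"
      then have "(x \<otimes> y) \<otimes> inv y \<in> generate G S"
        by (rule subgroup.m_closed[OF sub _ subgroup.m_inv_closed[OF sub True]])
      then show False using x y by (simp add: m_assoc)
    qed
    then have "x \<otimes> y \<in> generate G (carrier G - S)" using x y by (intro out) simp_all
    then have "inv x \<otimes> (x \<otimes> y) \<in> generate G (carrier G - S)"
      by (rule generate.eng[OF generate_m_inv_closed[OF _ out[OF x]], rotated]) simp
    then show ?thesis using x y by (simp add: m_assoc[symmetric])
  qed (use out y in blast)
  then show ?thesis using generate_incl[of "carrier G - S"] by blast
qed

section \<open>Inequivalent pairs of connection sets\<close>

lemma not_DCI_digraphE: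
  assumes V: "group V" and S: "S \<subseteq> carrier V" and not_DCI: "\<not> is_DCI_digraph V S"
  obtains S' \<phi> where "S' \<subseteq> carrier V" "cayley_iso V S V S' \<phi>"
    "\<forall>\<beta>\<in>iso V V. \<beta> ` S \<noteq> S'"
proof -
  obtain S' where S': "S' \<subseteq> carrier V" "digraph_iso (cayley_digraph V S) (cayley_digraph V S')"
    and no_auto: "\<And>\<alpha>. \<alpha> \<in> auto V \<Longrightarrow> \<alpha> ` S \<noteq> S'"
    using not_DCI unfolding is_DCI_digraph_def by blast
  obtain \<phi> where "cayley_iso V S V S' \<phi>"
    using digraph_iso_cayley_iff[OF V V S S'(1)] S'(2) by blast
  moreover have "\<beta> ` S \<noteq> S'" if "\<beta> \<in> iso V V" for \<beta>
  proof -
    have "restrict \<beta> (carrier V) ` S = \<beta> ` S" using S by (intro image_cong) auto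
    then show ?thesis using no_auto[OF restrict_iso_in_auto[OF V that]] by simp
  qed
  ultimately show ?thesis using that[OF S'(1)] by blast
qed

text \<open>Provides the two elements that distinguish the fibre over \<open>a\<close> from the
  one-point fibres. Empty sets cannot be inequivalent, and singletons are enlarged by the identity;
  the bound by \<open>max 2 (card S)\<close> preserves smallness for p = 3.\<close>

lemma inequivalent_card_ge_2:
  assumes V: "group V" and fin: "finite (carrier V)"
    and S: "S \<subseteq> carrier V" and S': "S' \<subseteq> carrier V" and iso: "cayley_iso V S V S' \<phi>"
    and no_iso: "\<forall>\<beta>\<in>iso V V. \<beta> ` S \<noteq> S'"
  obtains T T' where "T \<subseteq> carrier V" "T' \<subseteq> carrier V" "cayley_iso V T V T' \<phi>"
    "\<forall>\<beta>\<in>iso V V. \<beta> ` T \<noteq> T'" "2 \<le> card T" "card T \<le> max 2 (card S)" "S \<noteq> {}"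
proof -
  interpret V: group V by fact
  have card: "card S = card S'" by (rule cayley_iso_card[OF V V S S' iso])
  have finS: "finite S" "finite S'" using S S' fin by (auto intro: finite_subset)
  have "id \<in> iso V V" by (auto simp: iso_def hom_def)
  then have ne: "S \<noteq> S'" using no_iso by force
  then have S_ne: "S \<noteq> {}" using card finS by auto
  show thesis
  proof (cases "2 \<le> card S")
    case True
    then show ?thesis using that[OF S S' iso no_iso] S_ne by auto
  next
    case False
    moreover have "card S > 0" using S_ne finS by (simp add: card_gt_0_iff)
    ultimately have "card S = 1" by simp
    then obtain s s' where s: "S = {s}" "S' = {s'}" using card by (metis card_1_singletonE)
    have one: "\<one>\<^bsub>V\<^esub> \<in> S \<longleftrightarrow> \<one>\<^bsub>V\<^esub> \<in> S'" by (rule cayley_iso_one_mem[OF V V iso])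
    then have s_ne: "s \<noteq> \<one>\<^bsub>V\<^esub>" "s' \<noteq> \<one>\<^bsub>V\<^esub>" using s ne by auto
    have "\<beta> ` insert \<one>\<^bsub>V\<^esub> S \<noteq> insert \<one>\<^bsub>V\<^esub> S'" if \<beta>: "\<beta> \<in> iso V V" for \<beta>
    proof
      assume eq: "\<beta> ` insert \<one>\<^bsub>V\<^esub> S = insert \<one>\<^bsub>V\<^esub> S'"
      interpret \<beta>: group_hom V V \<beta>
        using \<beta> V by (simp add: group_hom_def group_hom_axioms_def iso_def)
      \<comment> \<open>An automorphism fixes the identity, so one that matches the enlarged sets
        must send \<open>s\<close> to \<open>s'\<close>.\<close>
      have "\<beta> s \<noteq> \<beta> \<one>\<^bsub>V\<^esub>"
        using \<beta> s s_ne S inj_on_eq_iff[of \<beta> "carrier V" s "\<one>\<^bsub>V\<^esub>"] by (simp add: iso_def bij_betw_def)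
      then have "\<beta> s = s'" using eq s by auto
      then show False using no_iso \<beta> s by simp
    qed
    moreover have "card (insert \<one>\<^bsub>V\<^esub> S) = 2" using s s_ne by simp
    ultimately show ?thesis
      using that[of "insert \<one>\<^bsub>V\<^esub> S" "insert \<one>\<^bsub>V\<^esub> S'"] S S' cayley_iso_insert_one[OF V V iso] S_ne
      by auto
  qed
qed

text \<open>The two alternatives in \<open>cond\<close> are the two criteria for \<alpha> to
  preserve \<open>V\<close>: the first is meant for p \<ge> 5, the second for p = 3.\<close>

lemma (in gadget_groups) not_CI_group_of_gadget:
  assumes H: "group H" and \<psi>: "\<psi> \<in> iso G H"
    and S: "S \<subseteq> carrier V" and S': "S' \<subseteq> carrier V" and iso: "cayley_iso V S V S' \<phi>"
    and no_iso: "\<forall>\<beta>\<in>iso V V. \<beta> ` S \<noteq> S'"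
    and two: "2 \<le> card S"
    and cond: "(\<forall>w\<in>fibres. w \<otimes>\<^bsub>W\<^esub> w \<in> fibres \<longrightarrow> w = \<one>\<^bsub>W\<^esub>) \<or>
      3 * card S < card (carrier V) \<and> 7 < card (carrier V)"
  shows "\<not> is_CI_group H"
proof (rule not_CI_groupI[OF G.group_axioms H \<psi> symmetric_gadget[OF S] symmetric_gadget[OF S']
      cayley_iso_gadget[OF S S' iso]])
  fix \<alpha> assume \<alpha>: "\<alpha> \<in> iso G G"
  have card: "card S = card S'" by (rule cayley_iso_card[OF V.group_axioms V.group_axioms S S' iso])
  show "\<alpha> ` gadget V W a b S \<noteq> gadget V W a b S'"
  proof
    assume \<alpha>S: "\<alpha> ` gadget V W a b S = gadget V W a b S'"
    have "\<alpha> ` (carrier V \<times> {\<one>\<^bsub>W\<^esub>}) = carrier V \<times> {\<one>\<^bsub>W\<^esub>}"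
      using cond
    proof
      assume "\<forall>w\<in>fibres. w \<otimes>\<^bsub>W\<^esub> w \<in> fibres \<longrightarrow> w = \<one>\<^bsub>W\<^esub>"
      then show ?thesis by (intro gadget_iso_image_V[OF _ \<alpha> \<alpha>S]) blast
    next
      assume "3 * card S < card (carrier V) \<and> 7 < card (carrier V)"
      then show ?thesis using gadget_iso_image_V_small[OF S' _ _ \<alpha> \<alpha>S] card by simp
    qed
    from gadget_rigid[OF S S' card two \<alpha> \<alpha>S this] show False using no_iso by blast
  qed
qed

section \<open>The concrete groups of exponent p\<close>

lemma comm_group_product_group:
  assumes "\<And>i. i \<in> I \<Longrightarrow> comm_group (G i)"
  shows "comm_group (product_group I G)"
proof -
  have grp: "\<And>i. i \<in> I \<Longrightarrow> group (G i)" using assms by (simp add: comm_group_def)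
  interpret group "product_group I G" using product_group[OF grp] .
  show ?thesis
  proof (rule group_comm_groupI)
    fix x y assume "x \<in> carrier (product_group I G)" "y \<in> carrier (product_group I G)"
    then show "x \<otimes>\<^bsub>product_group I G\<^esub> y = y \<otimes>\<^bsub>product_group I G\<^esub> x"
      using assms by (auto intro!: restrict_ext comm_monoid.m_comm simp: comm_group_def)
  qed
qed

lemma comm_group_DirProd:
  assumes "comm_group G" "comm_group H"
  shows "comm_group (G \<times>\<times> H)"
proof -
  interpret G: comm_group G by fact
  interpret H: comm_group H by fact
  interpret group "G \<times>\<times> H" by (intro DirProd_group G.group_axioms H.group_axioms)
  show ?thesis by (rule group_comm_groupI) (auto simp: G.m_comm H.m_comm)
qed

lemma Zmod_power_Suc_Suc_iso:
  assumes "p > 0"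
  shows "(\<lambda>(f, x, y). f(r := x, Suc r := y)) \<in>
    iso (Zmod_power p r \<times>\<times> (integer_mod_group p \<times>\<times> integer_mod_group p)) (Zmod_power p (r + 2))"
    (is "?\<psi> \<in> iso ?G ?H")
proof -
  have dom: "{..<r + 2} = insert (Suc r) (insert r {..<r})" by auto
  have "?\<psi> \<in> hom ?G ?H"
  proof (rule homI)
    fix x assume "x \<in> carrier ?G"
    then obtain f u v where x: "x = (f, u, v)"
      and f: "f \<in> (\<Pi>\<^sub>E i\<in>{..<r}. carrier (integer_mod_group p))"
      and u: "u \<in> carrier (integer_mod_group p)" and v: "v \<in> carrier (integer_mod_group p)"
      by auto
    have "f(r := u, Suc r := v) \<in> (\<Pi>\<^sub>E i\<in>insert (Suc r) (insert r {..<r}). carrier (integer_mod_group p))"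
      by (intro PiE_fun_upd u v f)
    then show "?\<psi> x \<in> carrier ?H" unfolding x carrier_product_group dom by simp
  next
    fix x y :: "(nat \<Rightarrow> int) \<times> int \<times> int"
    obtain f u v where x: "x = (f, u, v)" by (rule prod_cases3)
    obtain g u' v' where y: "y = (g, u', v')" by (rule prod_cases3)
    show "?\<psi> (x \<otimes>\<^bsub>?G\<^esub> y) = ?\<psi> x \<otimes>\<^bsub>?H\<^esub> ?\<psi> y"
      unfolding x y by (rule ext) (simp add: restrict_def)
  qed
  moreover have "inj_on ?\<psi> (carrier ?G)"
  proof (rule inj_onI)
    fix x y assume x: "x \<in> carrier ?G" and y: "y \<in> carrier ?G" and eq: "?\<psi> x = ?\<psi> y"
    obtain f u v where f: "x = (f, u, v)" by (rule prod_cases3)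
    obtain g u' v' where g: "y = (g, u', v')" by (rule prod_cases3)
    note xy = f g
    have eq': "(f(r := u, Suc r := v)) i = (g(r := u', Suc r := v')) i" for i
      using eq xy by simp
    have "f = g"
    proof (rule PiE_ext[of _ "{..<r}" "\<lambda>_. carrier (integer_mod_group p)"])
      show "f i = g i" if "i \<in> {..<r}" for i using eq'[of i] that by (auto split: if_splits)
    qed (use x y xy in auto)
    then show "x = y" using eq'[of r] eq'[of "Suc r"] xy by simp
  qed
  moreover have "carrier ?H \<subseteq> ?\<psi> ` carrier ?G"
  proof
    fix h assume h: "h \<in> carrier ?H"
    \<comment> \<open>From index r + 2 on, \<open>h\<close> is \<open>undefined\<close> by
      extensionality, and so is its restriction; the updates restore the values at \<open>r\<close>
      and \<open>Suc r\<close>.\<close>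
    have "h = ?\<psi> (restrict h {..<r}, h r, h (Suc r))"
      using PiE_arb[of h "{..<r + 2}"] h by (simp add: fun_eq_iff restrict_def)
    moreover have "h i \<in> carrier (integer_mod_group p)" if "i < r + 2" for i
      using h that by (auto dest: PiE_mem)
    then have "(restrict h {..<r}, h r, h (Suc r)) \<in> carrier ?G" by simp
    ultimately show "h \<in> ?\<psi> ` carrier ?G" by (rule image_eqI)
  qed
  moreover have "?\<psi> ` carrier ?G \<subseteq> carrier ?H"
    using \<open>?\<psi> \<in> hom ?G ?H\<close> by (intro image_subsetI) (rule hom_in_carrier)
  ultimately show ?thesis unfolding iso_def bij_betw_def by blast
qed

text \<open>The standard basis works because the inverse of 1 is represented by p - 1, which differs
  from 1 once p \<ge> 3.\<close>

lemma gadget_groups_Zmod: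
  assumes "p \<ge> 3" "comm_group V" "finite (carrier V)"
  shows "gadget_groups V (integer_mod_group p \<times>\<times> integer_mod_group p) (1, 0) (0, 1)"
proof -
  interpret V: comm_group V by fact
  interpret W: comm_group "integer_mod_group p \<times>\<times> integer_mod_group p"
    by (intro comm_group_DirProd abelian_integer_mod_group)
  have carr: "carrier (integer_mod_group p) = {0..<int p}"
    using assms by (simp add: carrier_integer_mod_group)
  show ?thesis
    by unfold_locales
      (use assms in \<open>auto simp: inv_DirProd carr zmod_minus1\<close>)
qed

text \<open>Elements of \<open>D\<close> have coordinates 0, 1 or p - 1, so their doubles have
  coordinates 0, 2 or p - 2. For p \<ge> 5 neither 2 nor p - 2 is among 0, 1 and p - 1.\<close>

lemma Zmod_no_squares:
  fixes p :: nat
  assumes p: "p \<ge> 5"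
  defines "W \<equiv> integer_mod_group p \<times>\<times> integer_mod_group p"
  defines "D \<equiv> {\<one>\<^bsub>W\<^esub>, (1, 0), inv\<^bsub>W\<^esub> (1, 0), (0, 1), inv\<^bsub>W\<^esub> (0, 1),
    (1, 0) \<otimes>\<^bsub>W\<^esub> (0, 1), inv\<^bsub>W\<^esub> ((1, 0) \<otimes>\<^bsub>W\<^esub> (0, 1))}"
  shows "\<forall>w\<in>D. w \<otimes>\<^bsub>W\<^esub> w \<in> D \<longrightarrow> w = \<one>\<^bsub>W\<^esub>"
proof -
  have carr: "carrier (integer_mod_group p) = {0..<int p}"
    using p by (simp add: carrier_integer_mod_group)
  have "(int p - 1 + (int p - 1)) mod int p = (- 2) mod int p"
    by (simp add: mod_eq_dvd_iff)
  also have "\<dots> = int p - 2" using p by (simp add: zmod_zminus1_eq_if)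
  finally have "(int p - 1 + (int p - 1)) mod int p = int p - 2" .
  then show ?thesis
    unfolding D_def W_def using p by (auto simp: inv_DirProd carr zmod_minus1)
qed

section \<open>Assembly for p = 2, p = 3 and p \<ge> 5\<close>

theorem theorem1p2:
  fixes p r :: nat
  assumes "prime p"
    and "\<not> is_DCI_group (Zmod_power p r)"
    and "p \<noteq> 3 \<or>
      (\<exists>S. S \<subseteq> carrier (Zmod_power p r) \<and> card S < p ^ (r - 1) \<and>
        \<not> is_DCI_digraph (Zmod_power p r) S)"
  shows "\<not> is_CI_group (Zmod_power p (r + 2))"
proof -
  define V where "V = Zmod_power p r"
  define W where "W = integer_mod_group p \<times>\<times> integer_mod_group p"
  have p2: "p \<ge> 2" using assms(1) by (rule prime_ge_2_nat)
  have carr: "carrier (integer_mod_group p) = {0..<int p}"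
    using p2 by (simp add: carrier_integer_mod_group)
  have V: "comm_group V" unfolding V_def
    by (intro comm_group_product_group abelian_integer_mod_group)
  then have Vg: "group V" by (simp add: comm_group_def)
  have H: "group (Zmod_power p (r + 2))" by simp
  have finV: "finite (carrier V)" unfolding V_def by (simp add: carr finite_PiE)
  have cardV: "card (carrier V) = p ^ r" unfolding V_def by (simp add: carr card_PiE)
  obtain \<psi> where \<psi>: "\<psi> \<in> iso (V \<times>\<times> W) (Zmod_power p (r + 2))"
    using Zmod_power_Suc_Suc_iso[of p r] p2 unfolding V_def W_def by force
  consider "p = 2" | "p = 3" | "p \<ge> 5"
  proof -
    have "p \<noteq> 4" using assms(1) by (auto simp: prime_nat_iff dest: spec[of _ 2])
    then show thesis using that p2 by linarith
  qed
  then show ?thesis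
  proof cases
    case 1
    obtain S where S: "S \<subseteq> carrier V" "\<not> is_DCI_digraph V S"
      using assms(2) unfolding is_DCI_group_def V_def by blast
    from Vg S obtain S' \<phi> where S': "S' \<subseteq> carrier V" and iso: "cayley_iso V S V S' \<phi>"
      and no_iso: "\<forall>\<beta>\<in>iso V V. \<beta> ` S \<noteq> S'"
      by (rule not_DCI_digraphE)
    have W: "group W" unfolding W_def by (intro DirProd_group group_integer_mod_group)
    have exp2: "v \<otimes>\<^bsub>V\<^esub> v = \<one>\<^bsub>V\<^esub>" if "v \<in> carrier V" for v
      unfolding V_def using 1 by (auto intro!: restrict_ext)
    note not_CI = not_CI_group_exponent_2[OF Vg W H finV exp2 \<psi>]
    show ?thesis
    \<comment> \<open>If \<open>S\<close> does not generate \<open>V\<close>, its complement does,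
      and complementation preserves both the isomorphism and the inequivalence.\<close>
    proof (cases "generate V S = carrier V")
      case True
      then show ?thesis using not_CI[OF _ S(1) S' iso] no_iso by blast
    next
      case False
      have "\<beta> ` (carrier V - S) \<noteq> carrier V - S'" if \<beta>: "\<beta> \<in> iso V V" for \<beta>
      proof
        assume eq: "\<beta> ` (carrier V - S) = carrier V - S'"
        have "\<beta> ` (carrier V - S) = carrier V - \<beta> ` S"
          using \<beta> S(1) inj_on_image_set_diff[of \<beta> "carrier V" "carrier V" S]
          by (simp add: iso_def bij_betw_def)
        moreover have "\<beta> ` S \<subseteq> carrier V" using \<beta> S(1) by (auto simp: iso_def hom_def)
        ultimately have "\<beta> ` S = S'" using eq S' by blast
        then show False using no_iso \<beta> by blast
      qed
      then show ?thesis
        using not_CI[OF _ _ _ cayley_iso_Compl[OF Vg Vg iso]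
            group.generate_complement[OF Vg S(1) False]] by blast
    qed
  next
    case 2
    obtain S where S: "S \<subseteq> carrier V" "\<not> is_DCI_digraph V S" and small: "card S < 3 ^ (r - 1)"
      using assms(3) 2 unfolding V_def by auto
    from Vg S obtain S' \<phi> where S': "S' \<subseteq> carrier V" "cayley_iso V S V S' \<phi>"
      "\<forall>\<beta>\<in>iso V V. \<beta> ` S \<noteq> S'"
      by (rule not_DCI_digraphE)
    from Vg finV S(1) S' obtain T T' where T: "T \<subseteq> carrier V" "T' \<subseteq> carrier V" "cayley_iso V T V T' \<phi>"
      "\<forall>\<beta>\<in>iso V V. \<beta> ` T \<noteq> T'" "2 \<le> card T" "card T \<le> max 2 (card S)" "S \<noteq> {}"
      by (rule inequivalent_card_ge_2)
    have "card S > 0" using T(7) S(1) finV by (auto simp: card_gt_0_iff intro: finite_subset)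
    \<comment> \<open>A nonempty \<open>S\<close> smaller than 3^(r - 1) forces r \<ge> 2, also
      under truncated subtraction at r = 0. Hence |V| \<ge> 9, above the bound 7.\<close>
    then have "3 ^ 0 < (3::nat) ^ (r - 1)" using small by simp
    then have r: "r \<ge> 2" by (simp only: power_strict_increasing_iff)
    then obtain k where k: "r = Suc (Suc k)" by (metis Suc_le_D numeral_2_eq_2 Suc_le_mono)
    have "card S < 3 * 3 ^ k" "card (carrier V) = 9 * 3 ^ k"
      using small by (simp_all add: k cardV 2)
    moreover have "(3::nat) ^ k \<ge> 1" by simp
    \<comment> \<open>If the maximum bounding |T| is 2, then 3 |T| \<le> 6 < 9; otherwise the bound
      on |S| is simply multiplied by 3.\<close>
    ultimately have "3 * card T < card (carrier V)" "7 < card (carrier V)"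
      using T(6) by linarith+
    then show ?thesis
      using gadget_groups.not_CI_group_of_gadget[OF gadget_groups_Zmod[OF _ V finV] H
          \<psi>[unfolded W_def] T(1-5)] 2 by simp
  next
    case 3
    obtain S where S: "S \<subseteq> carrier V" "\<not> is_DCI_digraph V S"
      using assms(2) unfolding is_DCI_group_def V_def by blast
    from Vg S obtain S' \<phi> where S': "S' \<subseteq> carrier V" "cayley_iso V S V S' \<phi>"
      "\<forall>\<beta>\<in>iso V V. \<beta> ` S \<noteq> S'"
      by (rule not_DCI_digraphE)
    from Vg finV S(1) S' obtain T T' where T: "T \<subseteq> carrier V" "T' \<subseteq> carrier V" "cayley_iso V T V T' \<phi>"
      "\<forall>\<beta>\<in>iso V V. \<beta> ` T \<noteq> T'" "2 \<le> card T"
      by (rule inequivalent_card_ge_2)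
    show ?thesis
      by (rule gadget_groups.not_CI_group_of_gadget[OF gadget_groups_Zmod[OF _ V finV] H
          \<psi>[unfolded W_def] T disjI1[OF Zmod_no_squares[OF 3]]]) (use 3 in simp)
  qed
qed

end
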